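(* Let $p$ be an odd prime and let $G$ be a finite $p$-group satisfying at least one of the following conditions: (i) $\gamma_m(G)\subseteq G^{p}$ for some integer $m$ with $2\leq m\leq p-1$; (ii) $\gamma_p(G)\subseteq G^{p^2}$. Then $\exp(G\wedge G)$ divides $\exp(G)$; hence $\exp(M(G))$ divides $\exp(G)$.
   Context: $\gamma_k(G)$ denotes the $k$-th term of the lower central series of $G$ ($\gamma_1(G)=G$, $\gamma_{k+1}(G)=[\gamma_k(G),G]$), and $G^{p^j}$ is the subgroup generated by all $p^j$-th powers. Conventions: ${}^g h = ghg^{-1}$, $[g,h]=ghg^{-1}h^{-1}$. The nonabelian tensor square $G\otimes G$ is generated by symbols $g\otimes h$ subject to $gg'\otimes h=({}^g g'\otimes {}^g h)(g\otimes h)$ and $g\otimes hh'=(g\otimes h)({}^h g\otimes {}^h h')$. The exterior square $G\wedge G$ is the quotient of $G\otimes G$ by the subgroup generated by all $x\otimes x$; $M(G)$ is the kernel of the map $G\wedge G\to[G,G]$, $g\wedge h\mapsto[g,h]$, and is isomorphic to $H_2(G,\mathbb{Z})$. *)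

theory Defs
  imports "HOL-Algebra.Generated_Groups" "HOL-Computational_Algebra.Primes"
begin

definition conjg :: "('a, 'b) monoid_scheme \<Rightarrow> 'a \<Rightarrow> 'a \<Rightarrow> 'a" where
  "conjg G g x = g \<otimes>\<^bsub>G\<^esub> x \<otimes>\<^bsub>G\<^esub> inv\<^bsub>G\<^esub> g"

definition commg :: "('a, 'b) monoid_scheme \<Rightarrow> 'a \<Rightarrow> 'a \<Rightarrow> 'a" where
  "commg G g h = g \<otimes>\<^bsub>G\<^esub> h \<otimes>\<^bsub>G\<^esub> inv\<^bsub>G\<^esub> g \<otimes>\<^bsub>G\<^esub> inv\<^bsub>G\<^esub> h"

text \<open>Lower central series: lcs G 1 = G, lcs G (k+1) = [lcs G k, G].
  (lcs G 0 is set to G as a harmless convention.)\<close>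
fun lcs :: "('a, 'b) monoid_scheme \<Rightarrow> nat \<Rightarrow> 'a set" where
  "lcs G 0 = carrier G"
| "lcs G (Suc 0) = carrier G"
| "lcs G (Suc (Suc k)) =
     generate G {commg G x y | x y. x \<in> lcs G (Suc k) \<and> y \<in> carrier G}"

definition power_subgroup :: "('a, 'b) monoid_scheme \<Rightarrow> nat \<Rightarrow> 'a set" where
  "power_subgroup G n = generate G {x [^]\<^bsub>G\<^esub> n | x. x \<in> carrier G}"

definition grp_exponent :: "('a, 'b) monoid_scheme \<Rightarrow> nat" where
  "grp_exponent H =
     (if \<exists>n::nat>0. \<forall>x\<in>carrier H. x [^]\<^bsub>H\<^esub> n = \<one>\<^bsub>H\<^esub>
      then LEAST n::nat. n > 0 \<and> (\<forall>x\<in>carrier H. x [^]\<^bsub>H\<^esub> n = \<one>\<^bsub>H\<^esub>)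
      else 0)"

text \<open>Words: lists of letters (generator, sign); True = positive letter.\<close>
type_synonym 'g word = "('g \<times> bool) list"

definition inv_word :: "'g word \<Rightarrow> 'g word" where
  "inv_word w = rev (map (\<lambda>(x, b). (x, \<not> b)) w)"

inductive pres_eq :: "'g word set \<Rightarrow> 'g word \<Rightarrow> 'g word \<Rightarrow> bool" for R where
  refl: "pres_eq R w w"
| sym: "pres_eq R u w \<Longrightarrow> pres_eq R w u"
| trans: "pres_eq R u v \<Longrightarrow> pres_eq R v w \<Longrightarrow> pres_eq R u w"
| cancel: "pres_eq R (u @ [(x, b), (x, \<not> b)] @ v) (u @ v)"
| rel: "r \<in> R \<Longrightarrow> pres_eq R (u @ r @ v) (u @ v)"

definition word_class :: "'g word set \<Rightarrow> 'g word \<Rightarrow> 'g word set" where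
  "word_class R w = {w'. pres_eq R w w'}"

definition presented_group :: "'g word set \<Rightarrow> ('g word set) monoid" where
  "presented_group R =
     \<lparr> carrier = range (word_class R),
       monoid.mult = (\<lambda>A B. {w. \<exists>a\<in>A. \<exists>b\<in>B. pres_eq R (a @ b) w}),
       one = word_class R [] \<rparr>"

text \<open>Defining relators of G \<wedge> G on generators g \<wedge> h (pairs (g,h) with g,h in G).
  Letters (g,h) with g or h outside the carrier are killed, so the group is the one
  generated by the symbols g \<wedge> h, g,h \<in> G, subject to the tensor relations
  gg' \<wedge> h = (gg'g^-1 \<wedge> ghg^-1)(g \<wedge> h), g \<wedge> hh' = (g \<wedge> h)(hgh^-1 \<wedge> hh'h^-1),
  and g \<wedge> g = 1.\<close>
definition ext_relators :: "('a, 'b) monoid_scheme \<Rightarrow> ('a \<times> 'a) word set" where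
  "ext_relators G =
     {[((g \<otimes>\<^bsub>G\<^esub> g', h), True)] @
        inv_word [((conjg G g g', conjg G g h), True), ((g, h), True)]
       | g g' h. g \<in> carrier G \<and> g' \<in> carrier G \<and> h \<in> carrier G}
   \<union> {[((g, h \<otimes>\<^bsub>G\<^esub> h'), True)] @
        inv_word [((g, h), True), ((conjg G h g, conjg G h h'), True)]
       | g h h'. g \<in> carrier G \<and> h \<in> carrier G \<and> h' \<in> carrier G}
   \<union> {[((g, g), True)] | g. g \<in> carrier G}
   \<union> {[((g, h), True)] | g h. \<not> (g \<in> carrier G \<and> h \<in> carrier G)}"

definition ext_square :: "('a, 'b) monoid_scheme \<Rightarrow> (('a \<times> 'a) word set) monoid" where
  "ext_square G = presented_group (ext_relators G)"

definition comm_eval :: "('a, 'b) monoid_scheme \<Rightarrow> ('a \<times> 'a) word \<Rightarrow> 'a" where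
  "comm_eval G w =
     foldr (\<lambda>((g, h), b) acc.
              (if b then commg G g h else inv\<^bsub>G\<^esub> (commg G g h)) \<otimes>\<^bsub>G\<^esub> acc)
           w \<one>\<^bsub>G\<^esub>"

definition schur_multiplier :: "('a, 'b) monoid_scheme \<Rightarrow> (('a \<times> 'a) word set) monoid" where
  "schur_multiplier G =
     (ext_square G)\<lparr> carrier :=
        {A \<in> carrier (ext_square G). \<exists>w\<in>A. comm_eval G w = \<one>\<^bsub>G\<^esub>} \<rparr>"

end

theory Submission
  imports Defs "HOL-Algebra.Group_Action" "HOL-Algebra.Multiplicative_Group"
begin

text \<open>
  Let \<open>G\<close> act on \<open>E = G \<and> G\<close> and work in the group generated, inside the permutations of \<open>E\<close>,
  by left multiplications and by the action of \<open>G\<close>; it is nilpotent along \<open>E\<close> because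
  \<open>[\<gamma>\<^sub>k(G) \<and> G, G] \<le> \<gamma>\<^sub>k\<^sub>+\<^sub>1(G) \<and> G\<close>.  Let \<open>W\<^sub>i\<close> be the subgroup generated by all \<open>y\<^bsup>q\<^esup> \<and> h\<close>
  with \<open>q = p\<^bsup>i\<^esup>\<close>, and let \<open>[W, k]\<close> be the \<open>k\<close>-fold commutator of \<open>W\<close> with the whole group.
  The Hall--Petrescu formula, applied to the homomorphism \<open>x \<mapsto> (x \<and> h)\<inverse> x\<close>, yields
  \<open>W\<^sub>i\<^sub>+\<^sub>1 \<le> W\<^sub>i\<^sup>p [W\<^sub>i, p - 1]\<close> and \<open>W\<^sub>i\<^sup>p \<le> W\<^sub>i\<^sub>+\<^sub>1 [W\<^sub>i, p - 1]\<close>.  The hypotheses say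
  \<open>[W\<^sub>0, p - 2] \<le> W\<^sub>1\<close> or \<open>[W\<^sub>0, p - 1] \<le> W\<^sub>2\<close>, and nilpotency propagates this to
  \<open>[W\<^sub>i, p - 2] \<le> W\<^sub>i\<^sub>+\<^sub>1\<close> or \<open>[W\<^sub>i, p - 1] \<le> W\<^sub>i\<^sub>+\<^sub>2\<close> for all \<open>i\<close>.  Hence \<open>W\<^sub>i\<^sup>p \<le> W\<^sub>i\<^sub>+\<^sub>1\<close>, so
  raising to the power \<open>p\<^sup>e = exp G\<close> maps \<open>E = W\<^sub>0\<close> into \<open>W\<^sub>e = 1\<close>.
\<close>

section \<open>Normal subgroups, commutators and powers\<close>

text \<open>The constant p - 1 comes from the last Hall--Petrescu factor. When (ax)^p is collected
  with a in a normal subgroup Y and x arbitrary, a factor of weight j \<ge> 2 lies in [Y, j - 1] and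
  has exponent binomial(p, j). For j < p this is divisible by p and leaves an element of [Y, 1]^p;
  for j = p it is 1 and leaves [Y, p - 1]. The obstacle is that [Y, 1]^p is not controlled in
  advance: power estimates come only modulo powers of deeper commutators, and inclusions only in the
  form X \<le> Z [X, 1]. Both kinds of error are pushed down until the iterated commutators of E
  vanish. Placing E and the action of G in one group turns the action into conjugation, so that x
  and its values x \<and> h can be multiplied and the powers of such a product compared in two
  ways.\<close>

class grp = monoid_mult +
  fixes iv :: "'a \<Rightarrow> 'a"
  assumes left_iv [simp]: "iv a * a = 1"
begin

lemma iv_mult_cancel [simp]: "iv a * (a * b) = b"
  by (simp flip: mult.assoc)

lemma right_iv [simp]: "a * iv a = 1"
  by (metis iv_mult_cancel left_iv mult_1_right)

lemma mult_iv_cancel [simp]: "a * (iv a * b) = b"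
  by (simp flip: mult.assoc)

lemma iv_unique: "a * b = 1 \<Longrightarrow> iv a = b"
  by (metis iv_mult_cancel mult_1_right)

lemma iv_iv [simp]: "iv (iv a) = a"
  by (simp add: iv_unique)

lemma iv_one [simp]: "iv 1 = 1"
  by (simp add: iv_unique)

lemma iv_mult [simp]: "iv (a * b) = iv b * iv a"
  by (simp add: iv_unique mult.assoc)

definition cm :: "'a \<Rightarrow> 'a \<Rightarrow> 'a" where
  "cm a b = a * b * iv a * iv b"

lemma iv_cm: "iv (cm a b) = cm b a"
  by (simp add: cm_def mult.assoc)

text \<open>Solved for one of the three double commutators, which becomes a product of conjugates of
  inverses of the other two. The simp rules above, with \<open>mult.assoc\<close>, complete the
  group axioms to a confluent rewriting system, so word identities of this kind reduce to normal
  forms.\<close>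

lemma Hall_Witt:
  "cm x (cm (iv y) z) =
     iv y * iv (x * cm z (cm (iv x) y) * iv x) * iv (z * cm y (cm (iv z) x) * iv z) * y"
  by (simp add: cm_def mult.assoc)

lemma iv_power: "iv (a ^ n) = iv a ^ n"
proof -
  have "a ^ n * iv a ^ n = 1"
  proof (induction n)
    case (Suc n)
    have "a ^ Suc n * iv a ^ Suc n = (a ^ n * a) * (iv a * iv a ^ n)"
      by (simp only: power_Suc2[of a] power_Suc[of "iv a"])
    with Suc show ?case by (simp add: mult.assoc)
  qed simp
  then show ?thesis by (rule iv_unique)
qed

lemma conj_power: "(g * a * iv g) ^ n = g * a ^ n * iv g"
  by (induction n) (simp_all add: mult.assoc)

definition subgp :: "'a set \<Rightarrow> bool" where
  "subgp N \<longleftrightarrow> 1 \<in> N \<and> (\<forall>x\<in>N. \<forall>y\<in>N. x * y \<in> N) \<and> (\<forall>x\<in>N. iv x \<in> N)"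

lemma subgpD:
  assumes "subgp N"
  shows "1 \<in> N" "x \<in> N \<Longrightarrow> y \<in> N \<Longrightarrow> x * y \<in> N" "x \<in> N \<Longrightarrow> iv x \<in> N"
  using assms by (auto simp: subgp_def)

lemma subgp_power: "subgp N \<Longrightarrow> x \<in> N \<Longrightarrow> x ^ n \<in> N"
  by (induction n) (auto simp: subgp_def)

lemma subgp_cm: "subgp N \<Longrightarrow> x \<in> N \<Longrightarrow> y \<in> N \<Longrightarrow> cm x y \<in> N"
  by (auto simp: subgp_def cm_def)

end

inductive_set gen :: "'a::grp set \<Rightarrow> 'a set" for S where
  gen_one: "1 \<in> gen S"
| gen_base: "s \<in> S \<Longrightarrow> s \<in> gen S"
| gen_mult: "x \<in> gen S \<Longrightarrow> y \<in> gen S \<Longrightarrow> x * y \<in> gen S"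
| gen_iv: "x \<in> gen S \<Longrightarrow> iv x \<in> gen S"

lemma subgp_gen: "subgp (gen S)"
  by (auto simp: subgp_def intro: gen.intros)

lemma gen_least: "S \<subseteq> N \<Longrightarrow> subgp N \<Longrightarrow> gen S \<subseteq> N"
proof
  fix x assume "S \<subseteq> N" "subgp N" and "x \<in> gen S"
  from this(3) show "x \<in> N"
    by induction (use \<open>S \<subseteq> N\<close> \<open>subgp N\<close> in \<open>auto simp: subgp_def\<close>)
qed

text \<open>The ambient group is a subset of the type: the type will later consist of all
  permutations of a set, where the subgroups of interest need not be normal.\<close>

locale op_group =
  fixes \<Gamma> :: "'a::grp set"
  assumes subgp_\<Gamma>: "subgp \<Gamma>"
begin

lemmas \<Gamma>_one = subgpD(1)[OF subgp_\<Gamma>]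
  and \<Gamma>_mult = subgpD(2)[OF subgp_\<Gamma>]
  and \<Gamma>_iv = subgpD(3)[OF subgp_\<Gamma>]

definition nsub :: "'a set \<Rightarrow> bool" where
  "nsub N \<longleftrightarrow> N \<subseteq> \<Gamma> \<and> subgp N \<and> (\<forall>g\<in>\<Gamma>. \<forall>x\<in>N. g * x * iv g \<in> N)"

lemma nsubD:
  assumes "nsub N"
  shows "subgp N" "1 \<in> N" "x \<in> N \<Longrightarrow> y \<in> N \<Longrightarrow> x * y \<in> N" "x \<in> N \<Longrightarrow> iv x \<in> N"
    "x \<in> N \<Longrightarrow> g \<in> \<Gamma> \<Longrightarrow> g * x * iv g \<in> N" "x \<in> N \<Longrightarrow> x \<in> \<Gamma>"
    "x \<in> N \<Longrightarrow> g \<in> \<Gamma> \<Longrightarrow> iv g * x * g \<in> N"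
proof -
  show "subgp N" "1 \<in> N" "x \<in> N \<Longrightarrow> y \<in> N \<Longrightarrow> x * y \<in> N" "x \<in> N \<Longrightarrow> iv x \<in> N"
    "x \<in> N \<Longrightarrow> g \<in> \<Gamma> \<Longrightarrow> g * x * iv g \<in> N" "x \<in> N \<Longrightarrow> x \<in> \<Gamma>"
    using assms by (auto simp: nsub_def subgp_def)
  assume "x \<in> N" "g \<in> \<Gamma>"
  then have "iv g * x * iv (iv g) \<in> N"
    using assms \<Gamma>_iv[of g] unfolding nsub_def by blast
  then show "iv g * x * g \<in> N" by simp
qed

lemma nsub_\<Gamma>: "nsub \<Gamma>"
  using subgp_\<Gamma> by (auto simp: nsub_def subgp_def)

lemma nsub_triv: "nsub {1}"
  using \<Gamma>_one by (auto simp: nsub_def subgp_def)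

lemma nsub_cm: "nsub N \<Longrightarrow> x \<in> N \<Longrightarrow> g \<in> \<Gamma> \<Longrightarrow> cm x g \<in> N"
  using nsubD(3)[of N x "g * iv x * iv g"] nsubD(5)[of N "iv x" g] nsubD(4)[of N x]
  by (simp add: cm_def mult.assoc)

text \<open>If \<open>S\<close> is not contained in \<Gamma>, no \<open>N\<close> qualifies and the
  intersection is the whole type; hence the assumption of \<open>nsub_ncl\<close>.\<close>

definition ncl :: "'a set \<Rightarrow> 'a set" where
  "ncl S = \<Inter>{N. nsub N \<and> S \<subseteq> N}"

lemma nsub_ncl: "S \<subseteq> \<Gamma> \<Longrightarrow> nsub (ncl S)"
proof -
  assume S: "S \<subseteq> \<Gamma>"
  then have "ncl S \<subseteq> \<Gamma>" using nsub_\<Gamma> by (auto simp: ncl_def)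
  then show ?thesis
    by (auto simp: nsub_def ncl_def subgp_def)
qed

lemma ncl_subset: "S \<subseteq> ncl S"
  by (auto simp: ncl_def)

lemma ncl_least: "S \<subseteq> N \<Longrightarrow> nsub N \<Longrightarrow> ncl S \<subseteq> N"
  by (auto simp: ncl_def)

text \<open>The product AB and, below, [A, \<Gamma>] and A^p are taken as normal closures, so that
  an inclusion in a normal subgroup can be checked on the evident generators.\<close>

definition Jn :: "'a set \<Rightarrow> 'a set \<Rightarrow> 'a set" where
  "Jn A B = ncl (A \<union> B)"

definition Cm :: "'a set \<Rightarrow> 'a set" where
  "Cm A = ncl {cm x g | x g. x \<in> A \<and> g \<in> \<Gamma>}"

definition Pw :: "nat \<Rightarrow> 'a set \<Rightarrow> 'a set" where
  "Pw p A = ncl {x ^ p | x. x \<in> A}"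

lemma nsub_Jn: "nsub A \<Longrightarrow> nsub B \<Longrightarrow> nsub (Jn A B)"
  unfolding Jn_def using nsubD(6)[of A] nsubD(6)[of B] by (intro nsub_ncl) auto

lemma Jn_upper1: "A \<subseteq> Jn A B" and Jn_upper2: "B \<subseteq> Jn A B"
  unfolding Jn_def using ncl_subset[of "A \<union> B"] by auto

lemma Jn_least: "A \<subseteq> Z \<Longrightarrow> B \<subseteq> Z \<Longrightarrow> nsub Z \<Longrightarrow> Jn A B \<subseteq> Z"
  unfolding Jn_def by (intro ncl_least) auto

lemma Jn_eq: assumes A: "nsub A" and B: "nsub B" shows "Jn A B = {a * b | a b. a \<in> A \<and> b \<in> B}"
proof
  let ?P = "{a * b | a b. a \<in> A \<and> b \<in> B}"
  have "nsub ?P"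
    unfolding nsub_def subgp_def
  proof (intro conjI ballI)
    show "?P \<subseteq> \<Gamma>" using nsubD(6)[OF A] nsubD(6)[OF B] \<Gamma>_mult by auto
    show "1 \<in> ?P" using nsubD(2)[OF A] nsubD(2)[OF B] by force
  next
    fix x y assume "x \<in> ?P" "y \<in> ?P"
    then obtain a b c d where h: "x = a * b" "y = c * d" "a \<in> A" "b \<in> B" "c \<in> A" "d \<in> B" by auto
    have "x * y = (a * c) * ((iv c * b * c) * d)" using h by (simp add: mult.assoc)
    moreover have "iv c * b * c \<in> B" using nsubD(7)[OF B] nsubD(6)[OF A] h by blast
    ultimately show "x * y \<in> ?P" using nsubD(3)[OF A] nsubD(3)[OF B] h by blast
  next
    fix x assume "x \<in> ?P"
    then obtain a b where h: "x = a * b" "a \<in> A" "b \<in> B" by auto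
    have "iv x = iv a * (a * iv b * iv a)" using h by (simp add: mult.assoc)
    moreover have "a * iv b * iv a \<in> B" using nsubD(5)[OF B] nsubD(4)[OF B] nsubD(6)[OF A] h by blast
    ultimately show "iv x \<in> ?P" using nsubD(4)[OF A] h by blast
  next
    fix g x assume g: "g \<in> \<Gamma>" and "x \<in> ?P"
    then obtain a b where h: "x = a * b" "a \<in> A" "b \<in> B" by auto
    have "g * x * iv g = (g * a * iv g) * (g * b * iv g)" using h by (simp add: mult.assoc)
    then show "g * x * iv g \<in> ?P" using nsubD(5)[OF A] nsubD(5)[OF B] h g by blast
  qed
  moreover have "A \<subseteq> ?P" "B \<subseteq> ?P"
    using nsubD(2)[OF A] nsubD(2)[OF B] by force+
  ultimately show "Jn A B \<subseteq> ?P" by (intro Jn_least)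
  show "?P \<subseteq> Jn A B"
    using nsubD(3)[OF nsub_Jn[OF A B]] Jn_upper1 Jn_upper2 by blast
qed

lemma nsub_Cm: "nsub A \<Longrightarrow> nsub (Cm A)"
  unfolding Cm_def using nsub_cm[of A] nsubD(6)[of A] by (intro nsub_ncl) auto

lemma Cm_mem: "x \<in> A \<Longrightarrow> g \<in> \<Gamma> \<Longrightarrow> cm x g \<in> Cm A"
  unfolding Cm_def by (rule subsetD[OF ncl_subset]) auto

lemma Cm_mem': "nsub A \<Longrightarrow> x \<in> A \<Longrightarrow> g \<in> \<Gamma> \<Longrightarrow> cm g x \<in> Cm A"
  using nsubD(4)[OF nsub_Cm[of A] Cm_mem[of x A g]] by (simp add: iv_cm)

lemma Cm_least: "(\<And>x g. x \<in> A \<Longrightarrow> g \<in> \<Gamma> \<Longrightarrow> cm x g \<in> Z) \<Longrightarrow> nsub Z \<Longrightarrow> Cm A \<subseteq> Z"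
  unfolding Cm_def by (intro ncl_least) auto

lemma Cm_mono: "A \<subseteq> B \<Longrightarrow> nsub B \<Longrightarrow> Cm A \<subseteq> Cm B"
  by (intro Cm_least nsub_Cm) (auto intro: Cm_mem)

lemma Cm_decr: "nsub A \<Longrightarrow> Cm A \<subseteq> A"
  by (intro Cm_least) (auto intro: nsub_cm)

lemma nsub_Pw: "nsub A \<Longrightarrow> nsub (Pw p A)"
  unfolding Pw_def using nsubD(6)[of A] subgp_power[OF subgp_\<Gamma>] by (intro nsub_ncl) auto

lemma Pw_mem: "x \<in> A \<Longrightarrow> x ^ p \<in> Pw p A"
  unfolding Pw_def by (rule subsetD[OF ncl_subset]) auto

lemma Pw_least: "(\<And>x. x \<in> A \<Longrightarrow> x ^ p \<in> Z) \<Longrightarrow> nsub Z \<Longrightarrow> Pw p A \<subseteq> Z"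
  unfolding Pw_def by (intro ncl_least) auto

lemma Pw_mono: "A \<subseteq> B \<Longrightarrow> nsub B \<Longrightarrow> Pw p A \<subseteq> Pw p B"
  by (intro Pw_least nsub_Pw) (auto intro: Pw_mem)

lemma Pw_decr: "nsub A \<Longrightarrow> Pw p A \<subseteq> A"
  by (intro Pw_least subgp_power nsubD(1))

text \<open>This set is the preimage of the centre of \<Gamma>/Z. Its normality allows the
  commutator subgroup of a normal closure to be bounded on generators, in
  \<open>Cm_ncl_least\<close>.\<close>

lemma nsub_commuting:
  assumes Z: "nsub Z"
  shows "nsub {x \<in> \<Gamma>. \<forall>g\<in>\<Gamma>. cm x g \<in> Z}"
  unfolding nsub_def subgp_def
proof (intro conjI ballI)
  note D = nsubD[OF Z]
  let ?C = "{x \<in> \<Gamma>. \<forall>g\<in>\<Gamma>. cm x g \<in> Z}"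
  show "1 \<in> ?C" using \<Gamma>_one D(2) by (simp add: cm_def mult.assoc)
  show "?C \<subseteq> \<Gamma>" by auto
  fix x assume x: "x \<in> ?C"
  { fix y assume y: "y \<in> ?C"
    have "cm (x * y) g \<in> Z" if g: "g \<in> \<Gamma>" for g
    proof -
      have "cm (x * y) g = (x * cm y g * iv x) * cm x g" by (simp add: cm_def mult.assoc)
      then show ?thesis using D(5)[of "cm y g" x] D(3) x y g by auto
    qed
    then show "x * y \<in> ?C" using x y \<Gamma>_mult by auto }
  { have "cm (iv x) g \<in> Z" if g: "g \<in> \<Gamma>" for g
    proof -
      have "cm (iv x) g = iv x * iv (cm x g) * x" by (simp add: cm_def mult.assoc)
      then show ?thesis using D(7)[OF D(4)] x g by auto
    qed
    then show "iv x \<in> ?C" using x \<Gamma>_iv by auto }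
  { fix h assume h: "h \<in> \<Gamma>"
    have "cm (h * x * iv h) g \<in> Z" if g: "g \<in> \<Gamma>" for g
    proof -
      have "cm (h * x * iv h) g = h * cm x (iv h * g * h) * iv h" by (simp add: cm_def mult.assoc)
      then show ?thesis using D(5) x g h \<Gamma>_iv \<Gamma>_mult by auto
    qed
    then show "h * x * iv h \<in> ?C" using x h \<Gamma>_iv \<Gamma>_mult by auto }
qed

lemma Cm_ncl_least:
  assumes "nsub Z" "S \<subseteq> \<Gamma>" "\<And>s g. s \<in> S \<Longrightarrow> g \<in> \<Gamma> \<Longrightarrow> cm s g \<in> Z"
  shows "Cm (ncl S) \<subseteq> Z"
proof -
  have "ncl S \<subseteq> {x \<in> \<Gamma>. \<forall>g\<in>\<Gamma>. cm x g \<in> Z}"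
    using assms by (intro ncl_least nsub_commuting) auto
  then show ?thesis using assms(1) by (intro Cm_least) auto
qed

lemma Cm_Jn: assumes "nsub A" "nsub B" shows "Cm (Jn A B) \<subseteq> Jn (Cm A) (Cm B)"
  unfolding Jn_def[of A]
proof (rule Cm_ncl_least)
  show "nsub (Jn (Cm A) (Cm B))" using assms by (intro nsub_Jn nsub_Cm)
qed (use assms in \<open>auto dest: nsubD(6) intro: Cm_mem subsetD[OF Jn_upper1] subsetD[OF Jn_upper2]\<close>)

lemma nsub_Cm_funpow: "nsub A \<Longrightarrow> nsub ((Cm ^^ k) A)"
  by (induction k) (auto intro: nsub_Cm)

lemma Cm_funpow_mono: "A \<subseteq> B \<Longrightarrow> nsub B \<Longrightarrow> (Cm ^^ k) A \<subseteq> (Cm ^^ k) B"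
  by (induction k) (use Cm_mono nsub_Cm_funpow in auto)

lemma Cm_funpow_decr:
  assumes "nsub A" "i \<le> j" shows "(Cm ^^ j) A \<subseteq> (Cm ^^ i) A"
  using assms(2)
proof (induction rule: dec_induct)
  case (step n)
  then show ?case using Cm_decr[OF nsub_Cm_funpow[OF assms(1)], of n] by auto
qed simp

lemma Cm_funpow_add: "(Cm ^^ i) ((Cm ^^ j) A) = (Cm ^^ (i + j)) A"
  by (simp add: funpow_add)

lemma Cm_funpow_Jn:
  assumes "nsub A" "nsub B" shows "(Cm ^^ k) (Jn A B) \<subseteq> Jn ((Cm ^^ k) A) ((Cm ^^ k) B)"
proof (induction k)
  case (Suc k)
  have "Cm ((Cm ^^ k) (Jn A B)) \<subseteq> Cm (Jn ((Cm ^^ k) A) ((Cm ^^ k) B))"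
    by (intro Cm_mono Suc nsub_Jn nsub_Cm_funpow assms)
  also have "\<dots> \<subseteq> Jn (Cm ((Cm ^^ k) A)) (Cm ((Cm ^^ k) B))"
    by (intro Cm_Jn nsub_Cm_funpow assms)
  finally show ?case by simp
qed simp

text \<open>Modulo \<open>N\<close>, the elements \<open>n * y\<close> and \<open>y\<close> coincide
  and so have the same powers.\<close>

lemma Pw_Jn: assumes N: "nsub N" and Y: "nsub Y" shows "Pw p (Jn N Y) \<subseteq> Jn N (Pw p Y)"
proof (rule Pw_least)
  show J: "nsub (Jn N (Pw p Y))" by (intro nsub_Jn nsub_Pw N Y)
  fix x assume "x \<in> Jn N Y"
  then obtain n y where h: "x = n * y" "n \<in> N" "y \<in> Y" using Jn_eq[OF N Y] by auto
  have "\<exists>m\<in>N. (n * y) ^ k = m * y ^ k" for k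
  proof (induction k)
    case 0
    then show ?case using nsubD(2)[OF N] by auto
  next
    case (Suc k)
    then obtain m where m: "m \<in> N" "(n * y) ^ k = m * y ^ k" by auto
    have "(n * y) ^ Suc k = (n * (y * m * iv y)) * y ^ Suc k"
      using m by (simp add: mult.assoc)
    moreover have "n * (y * m * iv y) \<in> N"
      using nsubD(3)[OF N] nsubD(5)[OF N] m(1) h(2) nsubD(6)[OF Y h(3)] by simp
    ultimately show ?case by blast
  qed
  then obtain m where "m \<in> N" "x ^ p = m * y ^ p" using h by auto
  then show "x ^ p \<in> Jn N (Pw p Y)"
    using nsubD(3)[OF J, of m "y ^ p"] Pw_mem[OF h(3), of p] Jn_upper1[of N "Pw p Y"]
      Jn_upper2[of "Pw p Y" N] by auto
qed

text \<open>Three subgroups lemma, by induction on \<open>j\<close>, for the two iterated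
  commutators and \<Gamma>. With weight i + 1 given to the i-fold commutator, weights add; this
  explains the index \<open>Suc (i + j)\<close>.\<close>

lemma Cm_funpow_cm:
  assumes Y: "nsub Y"
  shows "x \<in> (Cm ^^ i) Y \<Longrightarrow> y \<in> (Cm ^^ j) Y \<Longrightarrow> cm x y \<in> (Cm ^^ Suc (i + j)) Y"
proof (induction j arbitrary: i x y)
  case 0
  then have "cm x y \<in> Cm ((Cm ^^ i) Y)" using nsubD(6)[OF Y, of y] by (intro Cm_mem) simp_all
  then show ?case by simp
next
  case (Suc j)
  let ?Z = "(Cm ^^ Suc (i + Suc j)) Y"
  have Z: "nsub ?Z" by (rule nsub_Cm_funpow[OF Y])
  note D = nsubD[OF Z]
  have Yk: "nsub ((Cm ^^ k) Y)" for k by (rule nsub_Cm_funpow[OF Y])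
  let ?C = "{c \<in> \<Gamma>. \<forall>u\<in>(Cm ^^ i) Y. cm u c \<in> ?Z}"
  have "nsub ?C"
    unfolding nsub_def subgp_def
  proof (intro conjI ballI)
    show "1 \<in> ?C" using \<Gamma>_one D(2) by (simp add: cm_def mult.assoc)
    show "?C \<subseteq> \<Gamma>" by auto
    fix c assume c: "c \<in> ?C"
    { fix d assume d: "d \<in> ?C"
      have "cm u (c * d) \<in> ?Z" if u: "u \<in> (Cm ^^ i) Y" for u
      proof -
        have "cm u (c * d) = cm u c * (c * cm u d * iv c)" by (simp add: cm_def mult.assoc)
        then show ?thesis using D(5)[of "cm u d" c] D(3) c d u by auto
      qed
      then show "c * d \<in> ?C" using c d \<Gamma>_mult by auto }
    { have "cm u (iv c) \<in> ?Z" if u: "u \<in> (Cm ^^ i) Y" for u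
      proof -
        have "cm u (iv c) = iv c * iv (cm u c) * c" by (simp add: cm_def mult.assoc)
        then show ?thesis using D(7)[OF D(4)] c u by auto
      qed
      then show "iv c \<in> ?C" using c \<Gamma>_iv by auto }
    { fix h assume h: "h \<in> \<Gamma>"
      have "cm u (h * c * iv h) \<in> ?Z" if u: "u \<in> (Cm ^^ i) Y" for u
      proof -
        have "cm u (h * c * iv h) = h * cm (iv h * u * h) c * iv h" by (simp add: cm_def mult.assoc)
        then show ?thesis using D(5) c h nsubD(7)[OF Yk u h] by auto
      qed
      then show "h * c * iv h \<in> ?C" using c h \<Gamma>_iv \<Gamma>_mult by auto }
  qed
  moreover have "cm y g \<in> ?C" if y: "y \<in> (Cm ^^ j) Y" and g: "g \<in> \<Gamma>" for y g
  proof -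
    have "cm u (cm y g) \<in> ?Z" if u: "u \<in> (Cm ^^ i) Y" for u
    proof -
      have y': "iv y \<in> (Cm ^^ j) Y" by (rule nsubD(4)[OF Yk y])
      have u': "iv u \<in> (Cm ^^ i) Y" by (rule nsubD(4)[OF Yk u])
      have "cm (iv g) u \<in> (Cm ^^ Suc i) Y"
        using Cm_mem'[OF Yk u \<Gamma>_iv[OF g]] by simp
      from Suc.IH[OF this y'] have "cm (iv y) (cm (iv g) u) \<in> ?Z"
        using D(4) iv_cm by (metis add_Suc add_Suc_right)
      then have 1: "g * cm (iv y) (cm (iv g) u) * iv g \<in> ?Z" using D(5) g by blast
      have "cm (iv u) (iv y) \<in> (Cm ^^ Suc (i + j)) Y" by (rule Suc.IH[OF u' y'])
      then have "cm g (cm (iv u) (iv y)) \<in> ?Z" using Cm_mem'[OF Yk _ g] by fastforce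
      then have 2: "u * cm g (cm (iv u) (iv y)) * iv u \<in> ?Z"
        using D(5) nsubD(6)[OF Yk u] by blast
      \<comment> \<open>Inserting \<open>iv y\<close> in \<open>Hall_Witt\<close> makes the inner
        commutator \<open>cm y g\<close>; facts \<open>1\<close> and \<open>2\<close> place the two
        remaining terms in \<open>?Z\<close>.\<close>
      have "cm u (cm y g) = y * (iv (u * cm g (cm (iv u) (iv y)) * iv u) *
          iv (g * cm (iv y) (cm (iv g) u) * iv g)) * iv y"
        using Hall_Witt[of u "iv y" g] by (simp add: mult.assoc)
      then show ?thesis
        using D(3)[OF D(4)[OF 2] D(4)[OF 1]] D(5)[of _ y] nsubD(6)[OF Yk y] by metis
    qed
    moreover have "cm y g \<in> \<Gamma>" using nsubD(6)[OF Yk y] g subgp_cm[OF subgp_\<Gamma>] by blast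
    ultimately show ?thesis by auto
  qed
  ultimately have "Cm ((Cm ^^ j) Y) \<subseteq> ?C" by (intro Cm_least) auto
  then show ?case using Suc.prems by auto
qed

end

section \<open>The Hall--Petrescu formula\<close>

text \<open>Since \<open>[cubefn S x, cubefn T y] = cubefn (S \<union> T) [x, y]\<close>, products of such functions can be
  collected in order of increasing \<open>|S|\<close>.  The function \<open>U \<mapsto> w(|U|)\<close> with
  \<open>w(n) = x\<^sup>-\<^sup>n a\<^sup>-\<^sup>n (ax)\<^sup>n\<close> is such a product, and by symmetry the coefficient at \<open>S\<close> depends only
  on \<open>|S|\<close>; evaluating at the full set produces the binomial exponents.\<close>
definition cubefn :: "nat set \<Rightarrow> 'a::grp \<Rightarrow> nat set \<Rightarrow> 'a" where
  "cubefn S x U = (if S \<subseteq> U then x else 1)"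

primrec cube :: "(nat \<Rightarrow> 'a::grp set) \<Rightarrow> nat set list \<Rightarrow> (nat set \<Rightarrow> 'a) set" where
  "cube P [] = {\<lambda>U. 1}"
| "cube P (S # L) = {\<lambda>U. cubefn S x U * h U | x h. x \<in> P (card S) \<and> h \<in> cube P L}"

lemma cube_ConsI:
  "x \<in> P (card S) \<Longrightarrow> h \<in> cube P L \<Longrightarrow> (\<lambda>U. cubefn S x U * h U) \<in> cube P (S # L)"
  by auto

declare cube.simps(2) [simp del]

text \<open>Moving a factor at T past one at S creates a factor at T \<union> S. Closure under
  unions keeps it in the list, and the order by cardinality lets the head be removed without losing
  that closure.\<close>

definition up_list :: "nat \<Rightarrow> nat set list \<Rightarrow> bool" where
  "up_list n L \<longleftrightarrow> distinct L \<and> sorted (map card L) \<and>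
     (\<forall>S\<in>set L. S \<subseteq> {..<n} \<and> (\<forall>T. T \<subseteq> {..<n} \<longrightarrow> T \<union> S \<in> set L))"

lemma up_list_tl: assumes "up_list n (S # L)" shows "up_list n L"
  unfolding up_list_def
proof (intro conjI ballI allI impI)
  show "distinct L" "sorted (map card L)" using assms by (auto simp: up_list_def)
  fix S' assume S': "S' \<in> set L"
  then show "S' \<subseteq> {..<n}" using assms by (auto simp: up_list_def)
  fix T assume T: "T \<subseteq> {..<n}"
  have "T \<union> S' \<in> set (S # L)" using assms S' T unfolding up_list_def by auto
  moreover have "T \<union> S' \<noteq> S"
  proof
    assume eq: "T \<union> S' = S"
    have "card S \<le> card S'" using assms S' by (auto simp: up_list_def)
    moreover have "finite S" using assms finite_subset[of S "{..<n}"] by (auto simp: up_list_def)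
    ultimately have "S' = S" using eq by (metis card_seteq Un_upper2)
    then show False using assms S' by (auto simp: up_list_def)
  qed
  ultimately show "T \<union> S' \<in> set L" by auto
qed

lemma cube_base_mem:
  assumes "\<And>k. subgp (P k)"
  shows "(\<lambda>U. 1) \<in> cube P L" "S \<in> set L \<Longrightarrow> x \<in> P (card S) \<Longrightarrow> cubefn S x \<in> cube P L"
proof -
  have one: "(\<lambda>U. 1) \<in> cube P L" for L
  proof (induction L)
    case (Cons S L)
    have "(\<lambda>U. 1 :: 'a) = (\<lambda>U. cubefn S 1 U * 1)" by (auto simp: cubefn_def)
    with cube_ConsI[OF subgpD(1)[OF assms] Cons] show ?case by simp
  qed simp
  then show "(\<lambda>U. 1) \<in> cube P L" .
  show "S \<in> set L \<Longrightarrow> x \<in> P (card S) \<Longrightarrow> cubefn S x \<in> cube P L"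
  proof (induction L)
    case (Cons S' L)
    show ?case
    proof (cases "S = S'")
      case True
      have "(\<lambda>U. cubefn S x U * 1) \<in> cube P (S # L)" by (rule cube_ConsI[OF Cons(3) one])
      then show ?thesis using True by simp
    next
      case False
      then have "cubefn S x \<in> cube P L" using Cons by auto
      then have "(\<lambda>U. cubefn S' 1 U * cubefn S x U) \<in> cube P (S' # L)"
        by (rule cube_ConsI[OF subgpD(1)[OF assms]])
      then show ?thesis by (simp add: cubefn_def)
    qed
  qed simp
qed

locale filtration =
  fixes P :: "nat \<Rightarrow> 'a::grp set"
  assumes subgp_P: "subgp (P k)"
    and P_Suc: "P (Suc k) \<subseteq> P k"
    and P_cm: "x \<in> P i \<Longrightarrow> y \<in> P j \<Longrightarrow> cm x y \<in> P (i + j)"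
begin

lemma P_anti: "i \<le> j \<Longrightarrow> P j \<subseteq> P i"
  by (induction j rule: dec_induct) (use P_Suc in auto)

text \<open>The three claims are proved together because each one for \<open>S # L\<close> needs the
  others for \<open>L\<close>. Conjugation is stated for every \<open>T\<close>, listed or not,
  since the head must act on the tail after its removal. Conjugating the head factor creates a
  commutator at T \<union> S: if T \<subseteq> S, it merges into the coefficient at S, and otherwise
  its place is in the tail.\<close>

lemma cube_closed:
  assumes "up_list n L"
  shows "f \<in> cube P L \<Longrightarrow> g \<in> cube P L \<Longrightarrow> (\<lambda>U. f U * g U) \<in> cube P L"
    and "f \<in> cube P L \<Longrightarrow> (\<lambda>U. iv (f U)) \<in> cube P L"
    and "f \<in> cube P L \<Longrightarrow> T \<subseteq> {..<n} \<Longrightarrow> z \<in> P (card T) \<Longrightarrow>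
      (\<lambda>U. cubefn T z U * f U * iv (cubefn T z U)) \<in> cube P L"
  using assms
proof (induction L arbitrary: f g T z)
  case (Cons S L)
  { case 1
    note tl = up_list_tl[OF 1(3)]
    have S: "S \<subseteq> {..<n}" using 1(3) by (auto simp: up_list_def)
    from 1 obtain x h y k where h: "f = (\<lambda>U. cubefn S x U * h U)" "g = (\<lambda>U. cubefn S y U * k U)"
      "x \<in> P (card S)" "h \<in> cube P L" "y \<in> P (card S)" "k \<in> cube P L"
      unfolding cube.simps by blast
    have "(\<lambda>U. cubefn S (iv y) U * h U * iv (cubefn S (iv y) U)) \<in> cube P L"
      using Cons.IH(3)[where f = h and T = S and z = "iv y", OF h(4) S _ tl] subgpD(3)[OF subgp_P h(5)]
      by simp
    from Cons.IH(1)[OF this h(6) tl]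
    have "(\<lambda>U. cubefn S (iv y) U * h U * iv (cubefn S (iv y) U) * k U) \<in> cube P L" .
    moreover have "(\<lambda>U. f U * g U) = (\<lambda>U. cubefn S (x * y) U *
        (cubefn S (iv y) U * h U * iv (cubefn S (iv y) U) * k U))"
      by (auto simp: h cubefn_def mult.assoc)
    ultimately show ?case
      using cube_ConsI[where P = P and S = S, OF subgpD(2)[OF subgp_P h(3,5)]] by simp
  next
    case 2
    note tl = up_list_tl[OF 2(2)]
    have S: "S \<subseteq> {..<n}" using 2(2) by (auto simp: up_list_def)
    from 2 obtain x h where h: "f = (\<lambda>U. cubefn S x U * h U)" "x \<in> P (card S)" "h \<in> cube P L"
      unfolding cube.simps by blast
    have "(\<lambda>U. cubefn S x U * iv (h U) * iv (cubefn S x U)) \<in> cube P L"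
      using Cons.IH(3)[OF Cons.IH(2)[OF h(3) tl] S h(2) tl] .
    moreover have "(\<lambda>U. iv (f U)) = (\<lambda>U. cubefn S (iv x) U *
        (cubefn S x U * iv (h U) * iv (cubefn S x U)))"
      by (auto simp: h cubefn_def mult.assoc)
    ultimately show ?case
      using cube_ConsI[where P = P and S = S, OF subgpD(3)[OF subgp_P h(2)]] by simp
  next
    case 3
    note tl = up_list_tl[OF 3(4)]
    have S: "S \<subseteq> {..<n}" using 3(4) by (auto simp: up_list_def)
    from 3 obtain x h where h: "f = (\<lambda>U. cubefn S x U * h U)" "x \<in> P (card S)" "h \<in> cube P L"
      unfolding cube.simps by blast
    have h': "(\<lambda>U. cubefn T z U * h U * iv (cubefn T z U)) \<in> cube P L"
      using Cons.IH(3)[OF h(3) 3(2,3) tl] .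
    have c: "cm z x \<in> P (card T + card S)" using P_cm 3 h by blast
    show ?case
    proof (cases "T \<subseteq> S")
      case True
      have zx: "cm z x * x \<in> P (card S)"
        using c P_anti[of "card S" "card T + card S"] subgpD(2)[OF subgp_P _ h(2)] by auto
      moreover have "(\<lambda>U. cubefn T z U * f U * iv (cubefn T z U)) =
          (\<lambda>U. cubefn S (cm z x * x) U * (cubefn T z U * h U * iv (cubefn T z U)))"
        by (auto simp: h cubefn_def cm_def mult.assoc subset_trans[OF True])
      ultimately show ?thesis using cube_ConsI[where P = P and S = S, OF zx h'] by simp
    next
      case False
      have TS: "T \<union> S \<in> set (S # L)"
        using 3(4) 3(2) unfolding up_list_def by (meson list.set_intros(1))
      moreover have "T \<union> S \<noteq> S" using False by blast
      ultimately have "T \<union> S \<in> set L" by simp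
      moreover have "cm z x \<in> P (card (T \<union> S))"
        using c P_anti[OF card_Un_le[of T S]] by blast
      ultimately have "cubefn (T \<union> S) (cm z x) \<in> cube P L"
        by (rule cube_base_mem(2)[where P = P, OF subgp_P])
      then have "(\<lambda>U. cubefn S (iv x) U * cubefn (T \<union> S) (cm z x) U * iv (cubefn S (iv x) U)) \<in> cube P L"
        using Cons.IH(3)[where f = "cubefn (T \<union> S) (cm z x)" and T = S and z = "iv x", OF _ S _ tl]
          subgpD(3)[OF subgp_P h(2)] by simp
      from Cons.IH(1)[OF this h' tl]
      have q: "(\<lambda>U. cubefn S (iv x) U * cubefn (T \<union> S) (cm z x) U * iv (cubefn S (iv x) U) *
          (cubefn T z U * h U * iv (cubefn T z U))) \<in> cube P L" .
      moreover have "(\<lambda>U. cubefn T z U * f U * iv (cubefn T z U)) =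
          (\<lambda>U. cubefn S x U * (cubefn S (iv x) U * cubefn (T \<union> S) (cm z x) U * iv (cubefn S (iv x) U) *
          (cubefn T z U * h U * iv (cubefn T z U))))"
        by (auto simp: h cubefn_def cm_def mult.assoc)
      ultimately show ?thesis using cube_ConsI[where P = P and S = S, OF h(2) q] by simp
    qed }
qed auto

end

definition ev :: "nat set list \<Rightarrow> (nat set \<Rightarrow> 'a::grp) \<Rightarrow> nat set \<Rightarrow> 'a" where
  "ev L c U = prod_list (map (\<lambda>S. if S \<subseteq> U then c S else 1) L)"

lemma cube_ev:
  assumes "f \<in> cube P L" "distinct L"
  shows "\<exists>c. (\<forall>S\<in>set L. c S \<in> P (card S)) \<and> f = ev L c"
  using assms
proof (induction L arbitrary: f)
  case (Cons S L)
  then obtain x h where h: "f = (\<lambda>U. cubefn S x U * h U)" "x \<in> P (card S)" "h \<in> cube P L"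
    unfolding cube.simps by blast
  from Cons obtain c where c: "\<forall>S\<in>set L. c S \<in> P (card S)" "h = ev L c"
    using h(3) by auto
  have "ev L (c(S := x)) = ev L c"
    using Cons.prems by (auto simp: ev_def fun_eq_iff intro!: arg_cong[where f = prod_list])
  then have "f = ev (S # L) (c(S := x))"
    using h c by (auto simp: ev_def fun_eq_iff cubefn_def)
  moreover have "\<forall>T\<in>set (S # L). (c(S := x)) T \<in> P (card T)"
    using c h by auto
  ultimately show ?case by blast
qed (simp add: ev_def fun_eq_iff)

lemma ev_append: "ev (L @ L') c U = ev L c U * ev L' c U"
  by (simp add: ev_def)

section \<open>Subsets of an n-element set, collected by cardinality\<close>

definition level :: "nat \<Rightarrow> nat \<Rightarrow> nat set list" where
  "level n k = (SOME xs. set xs = {S. S \<subseteq> {..<n} \<and> card S = k} \<and> distinct xs)"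

lemma level: "set (level n k) = {S. S \<subseteq> {..<n} \<and> card S = k}" "distinct (level n k)"
proof -
  have "finite {S. S \<subseteq> {..<n} \<and> card S = k}" by simp
  from finite_distinct_list[OF this]
  have "set (level n k) = {S. S \<subseteq> {..<n} \<and> card S = k} \<and> distinct (level n k)"
    unfolding level_def by (rule someI_ex)
  then show "set (level n k) = {S. S \<subseteq> {..<n} \<and> card S = k}" "distinct (level n k)" by auto
qed

text \<open>The bound is strict: \<open>levels n m\<close> stops before cardinality
  \<open>m\<close>, so all subsets need \<open>levels n (Suc n)\<close>. The order inside a level
  may stay unspecified, because a level with one common coefficient evaluates to a power of
  it.\<close>

primrec levels :: "nat \<Rightarrow> nat \<Rightarrow> nat set list" where
  "levels n 0 = []"
| "levels n (Suc m) = levels n m @ level n m"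

lemma set_levels: "set (levels n m) = {S. S \<subseteq> {..<n} \<and> card S < m}"
  by (induction m) (auto simp: level less_Suc_eq)

lemma up_list_levels: "up_list n (levels n (Suc n))"
proof -
  have "distinct (levels n m) \<and> sorted (map card (levels n m))" for m
  proof (induction m)
    case (Suc m)
    have "sorted (map card (level n m))"
      by (subst map_cong[of _ _ _ "\<lambda>_. m"]) (auto simp: level map_replicate_const)
    with Suc show ?case by (auto simp: level sorted_append set_levels)
  qed simp
  moreover have "card S < Suc n" if "S \<subseteq> {..<n}" for S
    using card_mono[OF _ that] by simp
  ultimately show ?thesis
    by (auto simp: up_list_def set_levels simp del: levels.simps)
qed

lemma prod_list_if_const:
  "prod_list (map (\<lambda>S. if Q S then d else 1) xs) = (d::'a::monoid_mult) ^ length (filter Q xs)"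
  by (induction xs) auto

lemma ev_level_const:
  assumes "U \<subseteq> {..<n}" "\<And>S. S \<subseteq> {..<n} \<Longrightarrow> card S = m \<Longrightarrow> c S = d"
  shows "ev (level n m) c U = d ^ (card U choose m)"
proof -
  have "ev (level n m) c U = prod_list (map (\<lambda>S. if S \<subseteq> U then d else 1) (level n m))"
    unfolding ev_def using assms(2) by (intro arg_cong[where f = prod_list] map_cong) (auto simp: level)
  also have "\<dots> = d ^ length (filter (\<lambda>S. S \<subseteq> U) (level n m))"
    by (rule prod_list_if_const)
  also have "length (filter (\<lambda>S. S \<subseteq> U) (level n m)) = card (set (filter (\<lambda>S. S \<subseteq> U) (level n m)))"
    by (rule distinct_card[symmetric]) (simp add: level)
  also have "set (filter (\<lambda>S. S \<subseteq> U) (level n m)) = {S. S \<subseteq> U \<and> card S = m}"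
    using assms(1) by (auto simp: level)
  also have "card \<dots> = card U choose m"
    using finite_subset[OF assms(1)] by (intro n_subsets) auto
  finally show ?thesis .
qed

lemma ev_levels_const:
  assumes "U \<subseteq> {..<n}" "\<And>S. S \<subseteq> {..<n} \<Longrightarrow> card S < m \<Longrightarrow> c S = d (card S)"
  shows "ev (levels n m) c U = prod_list (map (\<lambda>j. d j ^ (card U choose j)) [0..<m])"
  using assms(2)
proof (induction m)
  case (Suc m)
  then show ?case using ev_level_const[OF assms(1), of m c "d m"] by (simp add: ev_append)
qed (simp add: ev_def)

text \<open>Among the sets with at least \<open>card S\<close> elements only \<open>S\<close> is
  contained in \<open>S\<close>. Its coefficient is therefore the last nontrivial factor of the
  value at \<open>S\<close> and is determined by that value and the smaller sets.\<close>

lemma ev_levels_top: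
  assumes S: "S \<subseteq> {..<n}" "card S < m"
  shows "ev (levels n m) c S = ev (levels n (card S)) c S * c S"
  using assms(2)
proof (induction m)
  case (Suc m)
  have fin: "finite S" using S finite_subset by blast
  have *: "T \<subseteq> S \<longleftrightarrow> T = S" if "card S \<le> card T" for T
    using card_seteq[OF fin _ that] by auto
  show ?case
  proof (cases "card S = m")
    case True
    have "ev (level n m) c S = ev (level n m) (\<lambda>_. c S) S"
      unfolding ev_def using * True by (intro arg_cong[where f = prod_list] map_cong) (auto simp: level)
    also have "\<dots> = c S" using S True by (subst ev_level_const[where d = "c S"]) auto
    finally show ?thesis using True by (simp add: ev_append)
  next
    case False
    have "ev (level n m) c S = ev (level n m) (\<lambda>_. 1) S"
      unfolding ev_def using * False Suc.prems
      by (intro arg_cong[where f = prod_list] map_cong) (auto simp: level)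
    also have "\<dots> = 1" using S by (subst ev_level_const[where d = 1]) auto
    finally show ?thesis using False Suc by (simp add: ev_append)
  qed
qed simp

context filtration
begin

text \<open>The function is the product of the singleton functions \<open>cubefn {m} y\<close>, each
  of which needs only y in \<open>P 1\<close>.\<close>

lemma linear_cube:
  assumes "y \<in> P 1"
  shows "(\<lambda>U. y ^ card (U \<inter> {..<n})) \<in> cube P (levels n (Suc n))"
proof -
  let ?L = "levels n (Suc n)"
  have "m \<le> n \<Longrightarrow> (\<lambda>U. y ^ card (U \<inter> {..<m})) \<in> cube P ?L" for m
  proof (induction m)
    case 0
    then show ?case using cube_base_mem(1)[where L = ?L and P = P, OF subgp_P] by simp
  next
    case (Suc m)
    have "cubefn {m} y \<in> cube P ?L"
    proof (rule cube_base_mem(2)[OF subgp_P])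
      show "{m} \<in> set ?L" using Suc.prems by (simp only: set_levels) auto
    qed (use assms in simp)
    then have "(\<lambda>U. y ^ card (U \<inter> {..<m}) * cubefn {m} y U) \<in> cube P ?L"
      using Suc by (intro cube_closed[OF up_list_levels]) auto
    moreover have "y ^ card (U \<inter> {..<Suc m}) = y ^ card (U \<inter> {..<m}) * cubefn {m} y U" for U
    proof -
      have "U \<inter> {..<Suc m} = (if m \<in> U then insert m (U \<inter> {..<m}) else U \<inter> {..<m})"
        by (auto simp: less_Suc_eq)
      then show ?thesis by (auto simp: cubefn_def power_commutes)
    qed
    ultimately show ?case by presburger
  qed
  then show ?thesis by simp
qed

text \<open>The product starts at weight 2 because the left side is 1 for the exponents 0 and 1,
  which forces the coefficients of weights 0 and 1 to vanish.\<close>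

theorem Hall_Petrescu:
  assumes a: "a \<in> P 1" and x: "x \<in> P 1" and n: "2 \<le> n"
  obtains d where "\<And>k. k \<le> n \<Longrightarrow> d k \<in> P k"
    "iv x ^ n * iv a ^ n * (a * x) ^ n = prod_list (map (\<lambda>j. d j ^ (n choose j)) [2..<Suc n])"
proof -
  let ?L = "levels n (Suc n)"
  define \<phi> where "\<phi> m = iv x ^ m * iv a ^ m * (a * x) ^ m" for m
  have "(\<lambda>U. \<phi> (card (U \<inter> {..<n}))) \<in> cube P ?L"
    unfolding \<phi>_def using a x subgpD[OF subgp_P[of 1]]
    by (intro cube_closed[OF up_list_levels] linear_cube) auto
  moreover have "distinct ?L" using up_list_levels by (auto simp: up_list_def)
  ultimately obtain c where c: "\<And>S. S \<in> set ?L \<Longrightarrow> c S \<in> P (card S)"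
    and ev: "\<And>U. \<phi> (card (U \<inter> {..<n})) = ev ?L c U"
    using cube_ev by (metis (no_types, lifting))
  have ev': "\<phi> (card U) = ev ?L c U" if "U \<subseteq> {..<n}" for U
    using ev[of U] that by (simp add: Int_absorb2)
  have card_le: "card S \<le> n" if "S \<subseteq> {..<n}" for S
    using card_mono[OF _ that] by simp
  define d where "d k = c {..<k}" for k
  \<comment> \<open>Both \<open>S\<close> and the initial segment of the same size satisfy the same
    equation, with equal contributions from smaller sets by induction; cancelling those identifies
    the two coefficients.\<close>
  have cd: "c S = d (card S)" if "S \<subseteq> {..<n}" for S
    using that
  proof (induction "card S" arbitrary: S rule: less_induct)
    case less
    have *: "\<phi> (card U) = prod_list (map (\<lambda>j. d j ^ (card U choose j)) [0..<card S]) * c U"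
      if U: "U \<subseteq> {..<n}" "card U = card S" for U
    proof -
      have "\<phi> (card U) = ev (levels n (card U)) c U * c U"
        using ev'[OF U(1)] ev_levels_top[OF U(1), of "Suc n" c] card_le[OF U(1)] by simp
      also have "ev (levels n (card U)) c U = prod_list (map (\<lambda>j. d j ^ (card U choose j)) [0..<card S])"
        using less.hyps U by (subst ev_levels_const[where d = d]) auto
      finally show ?thesis .
    qed
    have "{..<card S} \<subseteq> {..<n}" "card {..<card S} = card S" using card_le[OF less.prems] by auto
    from *[OF this] *[OF less.prems HOL.refl] show ?case
      unfolding d_def by (metis card_lessThan iv_mult_cancel)
  qed
  have main: "\<phi> m = prod_list (map (\<lambda>j. d j ^ (m choose j)) [0..<Suc n])" if "m \<le> n" for m
    using ev'[of "{..<m}"] ev_levels_const[of "{..<m}" n "Suc n" c d] cd that by auto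
  have upt: "[0..<Suc n] = 0 # 1 # [2..<Suc n]"
    using n by (simp add: upt_conv_Cons numeral_2_eq_2)
  have z: "prod_list (map (\<lambda>j. d j ^ (m choose j)) [2..<Suc n]) = 1" if "m < 2" for m
    using that
    by (subst map_cong[of _ _ _ "\<lambda>_. 1"]) (auto simp: binomial_eq_0 map_replicate_const)
  have "d 0 = 1" using main[of 0] z[of 0] n by (simp add: upt \<phi>_def del: upt_Suc)
  moreover from this have "d 1 = 1"
    using main[of 1] z[of 1] n by (simp add: upt \<phi>_def mult.assoc del: upt_Suc)
  ultimately have "\<phi> n = prod_list (map (\<lambda>j. d j ^ (n choose j)) [2..<Suc n])"
    using main[of n] by (simp add: upt del: upt_Suc)
  moreover have "d k \<in> P k" if "k \<le> n" for k
    using c[of "{..<k}"] that unfolding set_levels d_def by auto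
  ultimately show thesis using that[of d] unfolding \<phi>_def by blast
qed

end

section \<open>The p-th power of a product with one factor in a normal subgroup\<close>

lemma commuting_gen:
  assumes "op_group \<Gamma>" "op_group.nsub \<Gamma> N" "S \<subseteq> \<Gamma>" "b \<in> \<Gamma>" "\<And>s. s \<in> S \<Longrightarrow> cm s b \<in> N" "a \<in> gen S"
  shows "cm a b \<in> N"
proof -
  interpret op_group \<Gamma> by fact
  note D = nsubD[OF assms(2)]
  have "subgp {x \<in> \<Gamma>. cm x b \<in> N}"
    unfolding subgp_def
  proof (intro conjI ballI)
    show "1 \<in> {x \<in> \<Gamma>. cm x b \<in> N}" using \<Gamma>_one D(2) by (simp add: cm_def mult.assoc)
    fix x assume x: "x \<in> {x \<in> \<Gamma>. cm x b \<in> N}"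
    { fix y assume y: "y \<in> {x \<in> \<Gamma>. cm x b \<in> N}"
      have "cm (x * y) b = (x * cm y b * iv x) * cm x b" by (simp add: cm_def mult.assoc)
      then show "x * y \<in> {x \<in> \<Gamma>. cm x b \<in> N}" using D(5)[of "cm y b" x] D(3) x y \<Gamma>_mult by auto }
    { have "cm (iv x) b = iv x * iv (cm x b) * x" by (simp add: cm_def mult.assoc)
      then show "iv x \<in> {x \<in> \<Gamma>. cm x b \<in> N}" using D(7)[OF D(4)] x \<Gamma>_iv by auto }
  qed
  with assms have "gen S \<subseteq> {x \<in> \<Gamma>. cm x b \<in> N}" by (intro gen_least) auto
  then show ?thesis using assms(6) by auto
qed

context op_group
begin

text \<open>Hall--Petrescu for a filtration that starts with the subgroup generated by
  \<open>x\<close> and \<open>Y\<close>. The binomials strictly between weights 1 and p are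
  divisible by p and give elements of \<open>Pw p (Cm Y)\<close>; the factor of weight p lies in
  \<open>(Cm ^^ (p - 1)) Y\<close>.\<close>

lemma power_mult_congruence:
  assumes Y: "nsub Y" and Z: "nsub Z" and p: "Factorial_Ring.prime p"
    and PZ: "Pw p (Cm Y) \<subseteq> Z" and CZ: "(Cm ^^ (p - 1)) Y \<subseteq> Z"
    and a: "a \<in> Y" and x: "x \<in> \<Gamma>"
  shows "iv x ^ p * iv a ^ p * (a * x) ^ p \<in> Z"
proof -
  \<comment> \<open>\<Gamma> itself would be too large for the first term. \<open>H\<close> has a
    single generator outside the normal subgroup \<open>Y\<close>, so all commutators of
    \<open>H\<close> already lie in \<open>Cm Y\<close>; from index 2 on the filtration uses
    commutators with all of \<Gamma>.\<close>
  define H where "H = gen (insert x Y)"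
  define P where "P k = (if k \<le> 1 then H else (Cm ^^ (k - 1)) Y)" for k :: nat
  have sub: "insert x Y \<subseteq> \<Gamma>" using x nsubD(6)[OF Y] by auto
  have H\<Gamma>: "H \<subseteq> \<Gamma>" unfolding H_def by (rule gen_least[OF sub subgp_\<Gamma>])
  have YH: "Y \<subseteq> H" and xH: "x \<in> H" unfolding H_def by (auto intro: gen_base)
  have CY: "nsub ((Cm ^^ k) Y)" for k by (rule nsub_Cm_funpow[OF Y])
  have opg: "op_group \<Gamma>" by unfold_locales
  have HH: "cm u v \<in> Cm Y" if u: "u \<in> H" and v: "v \<in> H" for u v
  proof -
    have 1: "cm s w \<in> Cm Y" if "s \<in> insert x Y" "w \<in> insert x Y" for s w
    proof (cases "s \<in> Y")
      case True
      then show ?thesis using that x nsubD(6)[OF Y] by (auto intro: Cm_mem)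
    next
      case False
      then have "s = x" using that by auto
      then show ?thesis using that(2) Cm_mem'[OF Y _ x] nsubD(2)[OF nsub_Cm[OF Y]]
        by (auto simp: cm_def mult.assoc)
    qed
    have 2: "cm u w \<in> Cm Y" if "w \<in> insert x Y" for w
      using commuting_gen[OF opg nsub_Cm[OF Y] sub _ 1[OF _ that]] u that sub
      unfolding H_def by blast
    have "cm w u \<in> Cm Y" if "w \<in> insert x Y" for w
      using nsubD(4)[OF nsub_Cm[OF Y] 2[OF that]] by (simp add: iv_cm)
    then have "cm v u \<in> Cm Y"
      using commuting_gen[OF opg nsub_Cm[OF Y] sub, of u v] u v H\<Gamma> unfolding H_def by blast
    then show ?thesis using nsubD(4)[OF nsub_Cm[OF Y], of "cm v u"] by (simp add: iv_cm)
  qed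
  have Psub: "P k \<subseteq> \<Gamma>" for k using H\<Gamma> nsubD(6)[OF CY] by (auto simp: P_def)
  interpret filtration P
  proof
    show sg: "subgp (P k)" for k using nsubD(1)[OF CY] subgp_gen by (auto simp: P_def H_def)
    show "P (Suc k) \<subseteq> P k" for k
    proof -
      consider "k = 0" | "k = 1" | j where "k = Suc (Suc j)"
        by (metis One_nat_def not0_implies_Suc)
      then show ?thesis
      proof cases
        case 2
        then show ?thesis using Cm_decr[OF Y] YH by (auto simp: P_def)
      next
        case 3
        then show ?thesis using Cm_decr[OF CY, of "Suc j"] by (auto simp: P_def)
      qed (auto simp: P_def)
    qed
    fix u v i j assume u: "u \<in> P i" and v: "v \<in> P j"
    consider "i = 0" | "j = 0" | "i = 1" "j = 1" | "i = 1" "j > 1" | "j = 1" "i > 1" | "i > 1" "j > 1"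
      by linarith
    then show "cm u v \<in> P (i + j)"
    proof cases
      case 1
      show ?thesis
      proof (cases "j \<le> 1")
        case True
        then show ?thesis using 1 u v subgp_cm[OF sg[of 1]] by (auto simp: P_def)
      next
        case False
        then have "v \<in> (Cm ^^ (j - 1)) Y" "u \<in> \<Gamma>" using 1 u v Psub[of i] by (auto simp: P_def)
        from nsubD(4)[OF CY nsub_cm[OF CY this]] show ?thesis
          using 1 False by (simp add: P_def iv_cm)
      qed
    next
      case 2
      show ?thesis
      proof (cases "i \<le> 1")
        case True
        then show ?thesis using 2 u v subgp_cm[OF sg[of 1]] by (auto simp: P_def)
      next
        case False
        then have "u \<in> (Cm ^^ (i - 1)) Y" "v \<in> \<Gamma>" using 2 u v Psub[of j] by (auto simp: P_def)
        from nsub_cm[OF CY this] show ?thesis using 2 False by (simp add: P_def)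
      qed
    next
      case 3
      then show ?thesis using HH u v by (auto simp: P_def)
    next
      case 4
      then obtain j' where j': "j = Suc (Suc j')" by (metis less_imp_Suc_add add_Suc plus_1_eq_Suc)
      show ?thesis using 4 u v Psub[of 1] Cm_mem'[OF CY, of v "Suc j'" u] by (auto simp: P_def j')
    next
      case 5
      then obtain i' where i': "i = Suc (Suc i')" by (metis less_imp_Suc_add add_Suc plus_1_eq_Suc)
      show ?thesis using 5 u v Psub[of 1] Cm_mem[of u "(Cm ^^ Suc i') Y" v] by (auto simp: P_def i')
    next
      case 6
      then have "Suc (i - 1 + (j - 1)) = i + j - 1" by auto
      with 6 show ?thesis using Cm_funpow_cm[OF Y, of u "i - 1" v "j - 1"] u v by (simp add: P_def)
    qed
  qed
  have p2: "2 \<le> p" using p by (rule prime_ge_2_nat)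
  obtain d where d: "\<And>k. k \<le> p \<Longrightarrow> d k \<in> P k"
    and eq: "iv x ^ p * iv a ^ p * (a * x) ^ p = prod_list (map (\<lambda>j. d j ^ (p choose j)) [2..<Suc p])"
    using Hall_Petrescu[of a x p] a xH YH p2 by (auto simp: P_def)
  have "d j ^ (p choose j) \<in> Z" if j: "j \<in> set [2..<Suc p]" for j
  proof (cases "j = p")
    case True
    then show ?thesis using d[of p] CZ p2 by (auto simp: P_def)
  next
    case False
    then have "p dvd p choose j" using j by (intro dvd_choose_prime p) auto
    then obtain k where k: "p choose j = k * p" by (metis dvd_def mult.commute)
    have "d j \<in> P 2" using d[of j] j P_anti[of 2 j] by auto
    then have "d j \<in> Cm Y" by (simp add: P_def)
    then have "(d j ^ k) ^ p \<in> Z"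
      using PZ Pw_mem subgp_power[OF nsubD(1)[OF nsub_Cm[OF Y]]] by blast
    then show ?thesis by (simp add: k power_mult)
  qed
  then have "prod_list (map (\<lambda>j. d j ^ (p choose j)) xs) \<in> Z" if "set xs \<subseteq> set [2..<Suc p]" for xs
    using that by (induction xs) (use nsubD(2,3)[OF Z] in \<open>auto simp del: set_upt\<close>)
  then show ?thesis unfolding eq by blast
qed

end

section \<open>Powers modulo commutators\<close>

context op_group
begin

text \<open>Modulo \<open>Z\<close> the p-th power map is multiplicative on the normal closure, so
  the elements with p-th power in \<open>Z\<close> form a normal subgroup containing
  \<open>T\<close>.\<close>

lemma Pw_generators:
  assumes p: "Factorial_Ring.prime p" and Z: "nsub Z" and T: "T \<subseteq> \<Gamma>"
    and PZ: "Pw p (Cm (ncl T)) \<subseteq> Z" and CZ: "(Cm ^^ (p - 1)) (ncl T) \<subseteq> Z"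
    and TZ: "\<And>t. t \<in> T \<Longrightarrow> t ^ p \<in> Z"
  shows "Pw p (ncl T) \<subseteq> Z"
proof -
  note D = nsubD[OF Z]
  have Y: "nsub (ncl T)" by (rule nsub_ncl[OF T])
  let ?A = "{y \<in> ncl T. y ^ p \<in> Z}"
  have "nsub ?A"
    unfolding nsub_def subgp_def
  proof (intro conjI ballI)
    show "?A \<subseteq> \<Gamma>" using nsubD(6)[OF Y] by auto
    show "1 \<in> ?A" using D(2) nsubD(2)[OF Y] by simp
    fix x assume x: "x \<in> ?A"
    { fix y assume y: "y \<in> ?A"
      have "iv y ^ p * iv x ^ p * (x * y) ^ p \<in> Z"
        using x y nsubD(6)[OF Y] by (intro power_mult_congruence[OF Y Z p PZ CZ]) auto
      then have "(x ^ p * y ^ p) * (iv y ^ p * iv x ^ p * (x * y) ^ p) \<in> Z"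
        using D(3) x y by blast
      then have "(x * y) ^ p \<in> Z" by (simp add: mult.assoc flip: iv_power)
      then show "x * y \<in> ?A" using x y nsubD(3)[OF Y] by auto }
    show "iv x \<in> ?A" using x D(4)[of "x ^ p"] nsubD(4)[OF Y] by (auto simp: iv_power)
    fix g assume "g \<in> \<Gamma>"
    then show "g * x * iv g \<in> ?A" using x D(5) nsubD(5)[OF Y] by (simp add: conj_power)
  qed
  moreover have "T \<subseteq> ?A" using TZ ncl_subset by blast
  ultimately have "ncl T \<subseteq> ?A" by (intro ncl_least)
  then show ?thesis by (intro Pw_least Z) auto
qed

text \<open>Since \<open>v = [v,g] \<cdot> gvg\<inverse>\<close>, the congruence for \<open>(ax)\<^sup>p\<close> with
  \<open>a = [v,g]\<close> and \<open>x = gvg\<inverse>\<close> compares \<open>[v,g]\<^sup>p\<close> with \<open>[v\<^sup>p,g]\<close>.\<close>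
lemma power_cm_congruence:
  assumes Y: "nsub Y" and Z: "nsub Z" and p: "Factorial_Ring.prime p"
    and PZ: "Pw p (Cm (Cm Y)) \<subseteq> Z" and CZ: "(Cm ^^ p) Y \<subseteq> Z"
    and v: "v \<in> Y" and g: "g \<in> \<Gamma>"
  shows "cm (v ^ p) g \<in> Z \<longleftrightarrow> cm v g ^ p \<in> Z"
proof -
  note D = nsubD[OF Z]
  have v\<Gamma>: "v \<in> \<Gamma>" using v nsubD(6)[OF Y] by auto
  define a x where "a = cm v g" and "x = g * v * iv g"
  have x: "x \<in> \<Gamma>" using v\<Gamma> g \<Gamma>_mult \<Gamma>_iv by (auto simp: x_def)
  have "Suc (p - 1) = p" using prime_gt_0_nat[OF p] by simp
  then have "(Cm ^^ (p - 1)) (Cm Y) \<subseteq> Z" using CZ by (metis comp_apply funpow_Suc_right)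
  then have k: "iv x ^ p * iv a ^ p * (a * x) ^ p \<in> Z" (is "?k \<in> Z")
    using Cm_mem[OF v g] x unfolding a_def
    by (intro power_mult_congruence[OF nsub_Cm[OF Y] Z p PZ]) auto
  have ax: "a * x = v" by (simp add: a_def x_def cm_def mult.assoc)
  have xp: "x ^ p = g * v ^ p * iv g" by (simp add: x_def conj_power)
  have c: "cm (v ^ p) g = v ^ p * iv x ^ p" by (simp add: cm_def xp mult.assoc flip: iv_power)
  have xp\<Gamma>: "x ^ p \<in> \<Gamma>" by (rule subgp_power[OF subgp_\<Gamma> x])
  have k': "x ^ p * ?k * iv (x ^ p) \<in> Z" by (rule D(5)[OF k xp\<Gamma>])
  have eq: "x ^ p * ?k * iv (x ^ p) = iv (a ^ p) * cm (v ^ p) g"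
    by (simp add: ax c mult.assoc flip: iv_power)
  show ?thesis
  proof
    assume "cm (v ^ p) g \<in> Z"
    then have "cm (v ^ p) g * iv (iv (a ^ p) * cm (v ^ p) g) \<in> Z"
      using k' D(3,4) eq by metis
    then show "cm v g ^ p \<in> Z" by (simp add: a_def mult.assoc)
  next
    assume "cm v g ^ p \<in> Z"
    then have "a ^ p * (iv (a ^ p) * cm (v ^ p) g) \<in> Z"
      using k' D(3) eq a_def by metis
    then show "cm (v ^ p) g \<in> Z" by simp
  qed
qed

lemma Cm_Pw:
  assumes Y: "nsub Y" and Z: "nsub Z" and p: "Factorial_Ring.prime p"
    and PZ: "Pw p (Cm Y) \<subseteq> Z" and CZ: "(Cm ^^ p) Y \<subseteq> Z"
  shows "Cm (Pw p Y) \<subseteq> Z"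
  unfolding Pw_def
proof (rule Cm_ncl_least[OF Z])
  show "{x ^ p |x. x \<in> Y} \<subseteq> \<Gamma>" using nsubD(6)[OF Y] subgp_power[OF subgp_\<Gamma>] by auto
  fix s g assume "s \<in> {x ^ p |x. x \<in> Y}" and g: "g \<in> \<Gamma>"
  then obtain v where v: "v \<in> Y" "s = v ^ p" by auto
  have "Pw p (Cm (Cm Y)) \<subseteq> Z"
    using Pw_mono[OF Cm_decr[OF nsub_Cm[OF Y]] nsub_Cm[OF Y], of p] PZ by simp
  then have "cm (v ^ p) g \<in> Z \<longleftrightarrow> cm v g ^ p \<in> Z"
    by (intro power_cm_congruence[OF Y Z p _ CZ v(1) g])
  moreover have "cm v g ^ p \<in> Z" using PZ Pw_mem[OF Cm_mem[OF v(1) g]] by auto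
  ultimately show "cm s g \<in> Z" using v by simp
qed

text \<open>The converse of \<open>Cm_Pw\<close>, again from \<open>power_cm_congruence\<close>.
  That congruence handles only the generators \<open>cm v g\<close>; passing to all of
  \<open>Cm Y\<close> goes through \<open>Pw_generators\<close> and relies on the bound for the
  powers of \<open>Cm (Cm Y)\<close>.\<close>

lemma Pw_Cm:
  assumes Y: "nsub Y" and Z: "nsub Z" and p: "Factorial_Ring.prime p"
    and CPZ: "Cm (Pw p Y) \<subseteq> Z" and PZ: "Pw p (Cm (Cm Y)) \<subseteq> Z" and CZ: "(Cm ^^ p) Y \<subseteq> Z"
  shows "Pw p (Cm Y) \<subseteq> Z"
proof -
  let ?T = "{cm v g | v g. v \<in> Y \<and> g \<in> \<Gamma>}"
  have CY: "Cm Y = ncl ?T" by (simp add: Cm_def)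
  have "Suc (p - 1) = p" using prime_gt_0_nat[OF p] by simp
  then have "(Cm ^^ (p - 1)) (Cm Y) \<subseteq> Z" using CZ by (metis comp_apply funpow_Suc_right)
  moreover have "t ^ p \<in> Z" if t: "t \<in> ?T" for t
  proof -
    obtain v g where v: "v \<in> Y" "g \<in> \<Gamma>" "t = cm v g" using t by auto
    have "cm (v ^ p) g \<in> Z" using CPZ Cm_mem[OF Pw_mem[OF v(1)] v(2)] by auto
    then show ?thesis using power_cm_congruence[OF Y Z p PZ CZ v(1,2)] v(3) by simp
  qed
  moreover have "?T \<subseteq> \<Gamma>" using nsubD(6)[OF nsub_Cm[OF Y] Cm_mem] by auto
  ultimately show ?thesis
    using Pw_generators[OF p Z, of ?T] PZ unfolding CY by blast
qed

text \<open>Each round replaces [A^p, \<Gamma>] by [A, \<Gamma>]^p and a p-fold commutator of A. For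
  A = \<open>(Cm ^^ k) Y\<close> this error has index k + p, exactly where the error of the earlier
  rounds arrives after one more commutator.\<close>

lemma Cm_funpow_Pw:
  assumes Y: "nsub Y" and p: "Factorial_Ring.prime p"
  shows "(Cm ^^ k) (Pw p Y) \<subseteq> Jn (Pw p ((Cm ^^ k) Y)) ((Cm ^^ (k + p - 1)) Y)"
proof (induction k)
  case 0
  show ?case using Jn_upper1 by simp
next
  case (Suc k)
  let ?Y = "\<lambda>k. (Cm ^^ k) Y"
  have CY: "nsub (?Y k)" for k by (rule nsub_Cm_funpow[OF Y])
  have p0: "p > 0" by (rule prime_gt_0_nat[OF p])
  let ?Z = "Jn (Pw p (?Y (Suc k))) (?Y (Suc k + p - 1))"
  have Z: "nsub ?Z" by (intro nsub_Jn nsub_Pw CY)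
  have "Cm ((Cm ^^ k) (Pw p Y)) \<subseteq> Cm (Jn (Pw p (?Y k)) (?Y (k + p - 1)))"
    by (intro Cm_mono Suc nsub_Jn nsub_Pw CY)
  also have "\<dots> \<subseteq> Jn (Cm (Pw p (?Y k))) (Cm (?Y (k + p - 1)))"
    by (intro Cm_Jn nsub_Pw CY)
  also have "\<dots> \<subseteq> ?Z"
  proof (rule Jn_least[OF _ _ Z])
    have e: "Suc k + p - 1 = Suc (k + p - 1)" "p + k = Suc (k + p - 1)" using p0 by auto
    show "Cm (?Y (k + p - 1)) \<subseteq> ?Z" using Jn_upper2[of "?Y (Suc k + p - 1)"] unfolding e by simp
    show "Cm (Pw p (?Y k)) \<subseteq> ?Z"
    proof (rule Cm_Pw[OF CY Z p])
      show "Pw p (Cm (?Y k)) \<subseteq> ?Z" using Jn_upper1 by simp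
      show "(Cm ^^ p) (?Y k) \<subseteq> ?Z"
        unfolding Cm_funpow_add e using Jn_upper2 by simp
    qed
  qed
  finally show ?case by simp
qed

end

section \<open>Removing errors along a series that reaches the trivial group\<close>

locale nilpotent_action = op_group +
  fixes F :: "nat \<Rightarrow> 'a set" and c :: nat
  assumes nsub_F: "nsub (F k)" and Cm_F: "Cm (F k) \<subseteq> F (Suc k)" and F_c: "F c = {1}"
begin

lemma funpow_Cm_F: "X \<subseteq> F 0 \<Longrightarrow> (Cm ^^ k) X \<subseteq> F k"
proof (induction k)
  case (Suc k)
  then have "Cm ((Cm ^^ k) X) \<subseteq> Cm (F k)" by (intro Cm_mono nsub_F) auto
  then show ?case using Cm_F[of k] by simp
qed simp

text \<open>An argument of Nakayama type: substituting the inclusion into itself gives X \<le> Y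
  F(k) for every k, and F(c) is trivial.\<close>

lemma nilpotent_absorb:
  assumes X: "nsub X" and Y: "nsub Y" and XF: "X \<subseteq> F 0" and XY: "X \<subseteq> Jn Y (Cm X)"
  shows "X \<subseteq> Y"
proof -
  have "X \<subseteq> Jn Y (F k)" for k
  proof (induction k)
    case 0
    show ?case using XF Jn_upper2 by blast
  next
    case (Suc k)
    have J: "nsub (Jn Y (F k))" for k by (intro nsub_Jn Y nsub_F)
    have "Cm X \<subseteq> Cm (Jn Y (F k))" by (intro Cm_mono Suc J)
    also have "\<dots> \<subseteq> Jn (Cm Y) (Cm (F k))" by (intro Cm_Jn Y nsub_F)
    also have "\<dots> \<subseteq> Jn Y (F (Suc k))"
      using Cm_decr[OF Y] Cm_F[of k] Jn_upper1[of Y "F (Suc k)"] Jn_upper2[of "F (Suc k)" Y]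
      by (intro Jn_least J) auto
    finally have "Jn Y (Cm X) \<subseteq> Jn Y (F (Suc k))" by (intro Jn_least J Jn_upper1)
    then show ?case using XY by blast
  qed
  from this[of c] have "X \<subseteq> Jn Y {1}" by (simp add: F_c)
  moreover have "Jn Y {1} \<subseteq> Y" using nsubD(2)[OF Y] by (intro Jn_least Y) auto
  ultimately show ?thesis by blast
qed

text \<open>\<open>Pw_generators\<close> demands control of the powers of \<open>Cm (ncl T)\<close>;
  here they are only an error term. With V(k) the k-fold commutator of \<open>ncl T\<close>, one
  shows V(k)^p \<le> M V(k+1)^p for all k. The generators give k = 0, \<open>Pw_Cm\<close> passes to
  the next k up to the error [V(k+1)^p, \<Gamma>], which \<open>nilpotent_absorb\<close> removes.
  The chain ends because V(c) is trivial.\<close>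

lemma Pw_subset_of_generators:
  assumes p: "Factorial_Ring.prime p" and T: "T \<subseteq> \<Gamma>" and N: "nsub N" and TF: "ncl T \<subseteq> F 0"
    and M: "M = Jn N ((Cm ^^ (p - 1)) (ncl T))"
    and TM: "\<And>t. t \<in> T \<Longrightarrow> t ^ p \<in> Jn M (Pw p (Cm (ncl T)))"
  shows "Pw p (ncl T) \<subseteq> M"
proof -
  define V where "V k = (Cm ^^ k) (ncl T)" for k
  have V: "nsub (V k)" for k unfolding V_def by (intro nsub_Cm_funpow nsub_ncl T)
  have nM: "nsub M" unfolding M V_def[symmetric] by (intro nsub_Jn N V)
  have V_Suc: "Cm (V k) = V (Suc k)" for k by (simp add: V_def)
  have VM: "V k \<subseteq> M" if "k \<ge> p - 1" for k
    using Cm_funpow_decr[OF nsub_ncl[OF T] that] Jn_upper2[of "V (p - 1)" N]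
    unfolding V_def M by blast
  have VF: "V k \<subseteq> F 0" for k
    using Cm_funpow_decr[OF nsub_ncl[OF T], of 0 k] TF by (simp add: V_def)
  have step: "Pw p (V k) \<subseteq> Jn M (Pw p (V (Suc k)))" for k
  proof (induction k)
    case 0
    have "Pw p (ncl T) \<subseteq> Jn M (Pw p (V 1))"
    proof (rule Pw_generators[OF p _ T _ _ ])
      show "nsub (Jn M (Pw p (V 1)))" by (intro nsub_Jn nM nsub_Pw V)
      show "Pw p (Cm (ncl T)) \<subseteq> Jn M (Pw p (V 1))" using Jn_upper2 by (simp add: V_def)
      show "(Cm ^^ (p - 1)) (ncl T) \<subseteq> Jn M (Pw p (V 1))"
        using VM[of "p - 1"] Jn_upper1[of M] by (auto simp: V_def)
      show "t ^ p \<in> Jn M (Pw p (V 1))" if "t \<in> T" for t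
        using TM[OF that] by (simp add: V_def)
    qed
    then show ?case by (simp add: V_def)
  next
    case (Suc k)
    let ?Z = "Jn M (Pw p (V (Suc (Suc k))))"
    let ?Z' = "Jn ?Z (Cm (Pw p (V (Suc k))))"
    have Z: "nsub ?Z" by (intro nsub_Jn nM nsub_Pw V)
    have Z': "nsub ?Z'" by (intro nsub_Jn nM nsub_Pw V nsub_Cm)
    have up: "M \<subseteq> ?Z'" "Pw p (V (Suc (Suc k))) \<subseteq> ?Z'" "Cm (Pw p (V (Suc k))) \<subseteq> ?Z'"
      using Jn_upper1[of M] Jn_upper2[of _ M] Jn_upper1[of ?Z] Jn_upper2[of _ ?Z] by blast+
    have "Pw p (Cm (V k)) \<subseteq> ?Z'"
    proof (rule Pw_Cm[OF V Z' p])
      have "Cm (Pw p (V k)) \<subseteq> Cm (Jn M (Pw p (V (Suc k))))"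
        by (intro Cm_mono Suc nsub_Jn nM nsub_Pw V)
      also have "\<dots> \<subseteq> Jn (Cm M) (Cm (Pw p (V (Suc k))))" by (intro Cm_Jn nM nsub_Pw V)
      also have "\<dots> \<subseteq> ?Z'" using up Cm_decr[OF nM] by (intro Jn_least Z') auto
      finally show "Cm (Pw p (V k)) \<subseteq> ?Z'" .
      show "Pw p (Cm (Cm (V k))) \<subseteq> ?Z'" using up by (simp add: V_Suc)
      have "(Cm ^^ p) (V k) = V (p + k)" by (simp add: V_def Cm_funpow_add)
      moreover have "V (p + k) \<subseteq> M" by (rule VM) simp
      ultimately show "(Cm ^^ p) (V k) \<subseteq> ?Z'" using up by auto
    qed
    then have absorb: "Pw p (V (Suc k)) \<subseteq> ?Z'" by (simp add: V_Suc)
    have "Pw p (V (Suc k)) \<subseteq> F 0" using Pw_decr[OF V, of p "Suc k"] VF[of "Suc k"] by blast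
    then show ?case by (rule nilpotent_absorb[OF nsub_Pw[OF V] Z _ absorb])
  qed
  have "Pw p (V 0) \<subseteq> Jn M (Pw p (V k))" for k
  proof (induction k)
    case 0
    show ?case by (rule Jn_upper2)
  next
    case (Suc k)
    have "Jn M (Pw p (V k)) \<subseteq> Jn M (Pw p (V (Suc k)))"
      by (intro Jn_least step Jn_upper1 nsub_Jn nM nsub_Pw V)
    with Suc show ?case by blast
  qed
  moreover have "Pw p (V c) \<subseteq> {1}"
  proof -
    have "V c \<subseteq> {1}" using funpow_Cm_F[OF TF, of c] by (simp add: V_def F_c)
    then show ?thesis by (intro Pw_least nsub_triv) auto
  qed
  ultimately have "Pw p (V 0) \<subseteq> Jn M {1}"
    using Jn_least[of M "Jn M {1}" "Pw p (V c)"] Jn_upper1[of M "{1}"] Jn_upper2[of "{1}" M]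
      nsub_Jn[OF nM nsub_triv] by blast
  moreover have "Jn M {1} \<subseteq> M" using nsubD(2)[OF nM] by (intro Jn_least nM) auto
  ultimately show ?thesis by (auto simp: V_def)
qed


text \<open>The starting inclusion is carried from i to i + 1 by showing W(i+1) \<le> W(i)^p, or its
  analogue one index higher, and by moving the commutators inside the p-th power. What remains is a
  further commutator of the left side, suitable for \<open>nilpotent_absorb\<close>. Once
  [W(i), p - 1] \<le> W(i+1), the claim follows from \<open>W2\<close>.\<close>

lemma power_chain:
  assumes p: "Factorial_Ring.prime p" and W: "\<And>i. nsub (W i)" "W 0 \<subseteq> F 0" "\<And>i. W (Suc i) \<subseteq> W i"
    and W1: "\<And>i. W (Suc i) \<subseteq> Jn (Pw p (W i)) ((Cm ^^ (p - 1)) (W i))"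
    and W2: "\<And>i. Pw p (W i) \<subseteq> Jn (W (Suc i)) ((Cm ^^ (p - 1)) (W i))"
    and start: "(p \<ge> 2 \<and> (Cm ^^ (p - 2)) (W 0) \<subseteq> W 1) \<or> (Cm ^^ (p - 1)) (W 0) \<subseteq> W 2"
  shows "Pw p (W i) \<subseteq> W (Suc i)"
proof -
  define D where "D i k = (Cm ^^ k) (W i)" for i k
  have D: "nsub (D i k)" for i k unfolding D_def by (intro nsub_Cm_funpow W)
  have DD: "(Cm ^^ j) (D i k) = D i (j + k)" for i j k by (simp add: D_def Cm_funpow_add)
  have D0: "D i 0 = W i" for i by (simp add: D_def)
  have D_Suc: "Cm (D i k) = D i (Suc k)" for i k by (simp add: D_def)
  have D_mono: "D j k \<subseteq> D i k" if "i \<le> j" for i j k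
    unfolding D_def using lift_Suc_antimono_le[of W, OF W(3) that] by (intro Cm_funpow_mono W)
  have D_anti: "D i k \<subseteq> D i j" if "j \<le> k" for i j k
    unfolding D_def by (rule Cm_funpow_decr[OF W(1) that])
  have DF: "D i k \<subseteq> F 0" for i k using D_mono[of 0 i k] D_anti[of 0 k 0] W(2) D0 by auto
  have Cm_D_mono: "Cm A \<subseteq> D i (Suc k)" if "A \<subseteq> D i k" for A i k
    using Cm_mono[OF that D] by (simp add: D_Suc)
  \<comment> \<open>Distributes k commutators over W(i)^p X; \<open>Cm_funpow_Pw\<close> moves them
    inside the power at the cost of \<open>D i (k + p - 1)\<close>.\<close>
  have CmJn: "(Cm ^^ k) (Jn (Pw p (D i 0)) X) \<subseteq> Z"
    if "nsub X" "nsub Z" "Pw p (D i k) \<subseteq> Z" "D i (k + p - 1) \<subseteq> Z" "(Cm ^^ k) X \<subseteq> Z" for k i X Z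
  proof -
    have "(Cm ^^ k) (Pw p (D i 0)) \<subseteq> Jn (Pw p (D i k)) (D i (k + p - 1))"
      using Cm_funpow_Pw[OF W(1) p, of k i] by (simp add: D_def)
    also have "\<dots> \<subseteq> Z" using that by (intro Jn_least) auto
    finally show ?thesis
      using Cm_funpow_Jn[OF nsub_Pw[OF D] that(1), of k p i 0] that
        Jn_least[of "(Cm ^^ k) (Pw p (D i 0))" Z "(Cm ^^ k) X"] by blast
  qed
  note nJ = nsub_Jn nsub_Pw D nsub_Cm
  note W1' = W1[folded D0, folded D_def, unfolded DD add_0_right]
    and W2' = W2[folded D0, folded D_def, unfolded DD add_0_right]
  have p2: "p \<ge> 2" by (rule prime_ge_2_nat[OF p])
  have "D i (p - 1) \<subseteq> D (Suc i) 0"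
  proof (cases "(Cm ^^ (p - 1)) (W 0) \<subseteq> W 2")
    case False
    have p1: "p - 1 = Suc (p - 2)" using p2 by simp
    have "D i (p - 2) \<subseteq> D (Suc i) 0"
    proof (induction i)
      case 0
      show ?case using start False by (auto simp: D_def)
    next
      case (Suc i)
      let ?V = "D (Suc i)"
      \<comment> \<open>One commutator beyond the induction hypothesis puts the error term of
        \<open>W1\<close> into [W(i+1), \<Gamma>], where it is absorbed; this yields W(i+1) \<le>
        W(i)^p.\<close>
      have "D i (Suc (p - 2)) \<subseteq> ?V 1" using Cm_D_mono[OF Suc] by (simp add: D_Suc)
      then have "D i (p - 1) \<subseteq> ?V 1" by (simp only: p1)
      then have "?V 0 \<subseteq> Jn (Pw p (D i 0)) (?V 1)"
        using W1'[of i] Jn_least[of "Pw p (D i 0)" "Jn (Pw p (D i 0)) (?V 1)" "D i (p - 1)"]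
          Jn_upper1 Jn_upper2 nJ by (meson order_trans)
      then have V: "?V 0 \<subseteq> Pw p (D i 0)"
        unfolding One_nat_def D_Suc[symmetric] by (rule nilpotent_absorb[OF D nsub_Pw[OF D] DF])
      let ?Z = "Jn (D (Suc (Suc i)) 0) (?V (p - 1))"
      have PZ: "Pw p (?V 0) \<subseteq> ?Z" by (rule W2')
      have "?V (p - 2) = (Cm ^^ (p - 2)) (?V 0)" by (simp add: DD)
      also have "\<dots> \<subseteq> (Cm ^^ (p - 2)) (Pw p (D i 0))" by (intro Cm_funpow_mono V nJ)
      \<comment> \<open>\<open>CmJn\<close> speaks of a join, hence the trivial second
        factor.\<close>
      also have "\<dots> \<subseteq> (Cm ^^ (p - 2)) (Jn (Pw p (D i 0)) {1})"
        by (intro Cm_funpow_mono nJ nsub_triv Jn_upper1)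
      also have "\<dots> \<subseteq> ?Z"
      proof (rule CmJn)
        show "Pw p (D i (p - 2)) \<subseteq> ?Z" using Pw_mono[OF Suc D, of p] PZ by blast
        have "p - 2 + p - 1 = p - 1 + (p - 2)" using p2 by simp
        then have "D i (p - 2 + p - 1) = (Cm ^^ (p - 1)) (D i (p - 2))" by (simp only: DD)
        also have "\<dots> \<subseteq> (Cm ^^ (p - 1)) (?V 0)" by (intro Cm_funpow_mono Suc D)
        also have "\<dots> = ?V (p - 1)" by (simp add: DD)
        finally show "D i (p - 2 + p - 1) \<subseteq> ?Z" using Jn_upper2 by blast
        have "(Cm ^^ (p - 2)) {1} \<subseteq> (Cm ^^ 0) {1}" by (intro Cm_funpow_decr nsub_triv) simp
        then show "(Cm ^^ (p - 2)) {1} \<subseteq> ?Z" using nsubD(2)[OF nsub_Jn[OF D D]] by auto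
      qed (intro nJ nsub_triv)+
      finally have "?V (p - 2) \<subseteq> ?Z" .
      then have "?V (p - 2) \<subseteq> Jn (D (Suc (Suc i)) 0) (Cm (?V (p - 2)))" unfolding D_Suc p1 .
      then show ?case by (rule nilpotent_absorb[OF D D DF])
    qed
    moreover have "D i (p - 1) \<subseteq> D i (p - 2)" by (rule D_anti) simp
    ultimately show ?thesis by blast
  next
    case True
    have "D i (p - 1) \<subseteq> D (Suc (Suc i)) 0"
    proof (induction i)
      case 0
      show ?case using True by (simp add: D_def numeral_2_eq_2)
    next
      case (Suc i)
      let ?V = "D (Suc i)" and ?X = "D (Suc (Suc i))" and ?X' = "D (Suc (Suc (Suc i))) 0"
      have p1: "Suc (p - 1) = p" "p - 1 + p - 1 = (p - 1) + (p - 1)" using p2 by auto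
      have VX: "?V (p - 1) \<subseteq> ?X 0" using Suc D_mono[of i "Suc i" "p - 1"] by auto
      have PX: "Pw p (?X 0) \<subseteq> Jn ?X' (?X (p - 1))" by (rule W2')
      let ?Z = "Jn ?X' (?X (p - 1))"
      have Z: "nsub ?Z" by (intro nJ)
      have DX: "D i (p - 1 + p - 1) \<subseteq> ?X (p - 1)"
        using Cm_funpow_mono[OF Suc D, of "p - 1"] by (simp only: DD p1(2) add_0_right)
      \<comment> \<open>By \<open>W1\<close> and the induction hypothesis, W(i+1) \<le> W(i)^p
        W(i+2). Under p - 1 commutators the first factor yields [W(i), p - 1]^p \<le> W(i+2)^p,
        which \<open>PX\<close> bounds.\<close>
      have VZ: "?V (p - 1) \<subseteq> ?Z"
      proof -
        have "?V 0 \<subseteq> Jn (Pw p (D i 0)) (?X 0)"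
          using W1'[of i] Jn_least[of "Pw p (D i 0)" "Jn (Pw p (D i 0)) (?X 0)" "D i (p - 1)"]
            Suc Jn_upper1 Jn_upper2 nJ by (meson order_trans)
        then have "(Cm ^^ (p - 1)) (?V 0) \<subseteq> (Cm ^^ (p - 1)) (Jn (Pw p (D i 0)) (?X 0))"
          by (intro Cm_funpow_mono nJ)
        also have "\<dots> \<subseteq> ?Z"
        proof (rule CmJn)
          show "Pw p (D i (p - 1)) \<subseteq> ?Z" using Pw_mono[OF Suc D, of p] PX by blast
          show "D i (p - 1 + p - 1) \<subseteq> ?Z" using DX Jn_upper2 by blast
          show "(Cm ^^ (p - 1)) (?X 0) \<subseteq> ?Z" using Jn_upper2 by (simp add: DD)
        qed (intro nJ)+
        finally show ?thesis by (simp add: DD)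
      qed
      \<comment> \<open>\<open>W1\<close> gives W(i+2) \<le> W(i+1)^p [W(i+1), p - 1]. The second
        factor lies in \<open>?Z\<close>, and both parts of \<open>?Z\<close> fit into W(i+1)^p
        [W(i+2), \<Gamma>], so the error can be absorbed.\<close>
      have XV: "?X 0 \<subseteq> Pw p (?V 0)"
      proof -
        have Y: "nsub (Jn (Pw p (?V 0)) (Cm (?X 0)))" (is "nsub ?Y") by (intro nJ)
        have "?X (p - 1) \<subseteq> Cm (?X 0)" unfolding D_Suc using p2 by (intro D_anti) simp
        moreover have "Pw p (?X 0) \<subseteq> Pw p (?V 0)" by (intro Pw_mono D_mono D) simp
        ultimately have "Jn (Pw p (?X 0)) (?X (p - 1)) \<subseteq> ?Y"
          using Jn_upper1 Jn_upper2 by (intro Jn_least Y) (meson order_trans)+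
        with W1'[of "Suc (Suc i)"] have "?X' \<subseteq> ?Y" by blast
        moreover have "?X (p - 1) \<subseteq> ?Y"
          using \<open>?X (p - 1) \<subseteq> Cm (?X 0)\<close> Jn_upper2 by blast
        ultimately have "?Z \<subseteq> ?Y" by (intro Jn_least Y)
        then have "Jn (Pw p (?V 0)) (?V (p - 1)) \<subseteq> ?Y"
          using VZ Jn_upper1 by (intro Jn_least Y) auto
        with W1'[of "Suc i"] have "?X 0 \<subseteq> ?Y" by blast
        then show ?thesis by (rule nilpotent_absorb[OF D nsub_Pw[OF D] DF])
      qed
      \<comment> \<open>\<open>PX\<close> alone would leave the error \<open>?X (p - 1)\<close>. For
        commutators, \<open>power_cm_congruence\<close> trades \<open>cm v g ^ p\<close> for
        \<open>cm (v ^ p) g\<close>, and the extra commutator improves the error to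
        \<open>?X p\<close>.\<close>
      have PX1: "Pw p (?X 1) \<subseteq> Jn ?X' (?X p)"
      proof -
        let ?T = "{cm v g | v g. v \<in> ?X 0 \<and> g \<in> \<Gamma>}"
        have T: "ncl ?T = ?X 1" using D_Suc[of "Suc (Suc i)" 0] by (simp add: Cm_def)
        let ?N = "Jn ?X' (?X p)"
        have N: "nsub ?N" by (intro nJ)
        have pp: "(Cm ^^ (p - 1)) (?X 1) = ?X p" using p1 by (simp add: DD)
        \<comment> \<open>\<open>?X p\<close> is already below \<open>?N\<close>; it is joined again
          to match the shape of \<open>M\<close> in \<open>Pw_subset_of_generators\<close>.\<close>
        let ?M = "Jn ?N (?X p)"
        have M: "nsub ?M" by (intro nJ)
        have "Pw p (ncl ?T) \<subseteq> ?M"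
        proof (rule Pw_subset_of_generators[OF p _ N])
          show "?T \<subseteq> \<Gamma>" using nsubD(6)[OF nsub_Cm[OF D] Cm_mem] by auto
          show "ncl ?T \<subseteq> F 0" unfolding T by (rule DF)
          show "?M = Jn ?N ((Cm ^^ (p - 1)) (ncl ?T))" unfolding T pp ..
          fix t assume "t \<in> ?T"
          then obtain v g where v: "v \<in> ?X 0" "g \<in> \<Gamma>" "t = cm v g" by auto
          let ?Q = "Jn ?M (Pw p (Cm (ncl ?T)))"
          have Q: "nsub ?Q" unfolding T by (intro nJ)
          have NQ: "?N \<subseteq> ?Q" using Jn_upper1 by (meson order_trans)
          have "cm (v ^ p) g \<in> Cm (Pw p (?X 0))" by (intro Cm_mem Pw_mem v)
          moreover have "Cm (Pw p (?X 0)) \<subseteq> Cm ?Z" by (intro Cm_mono PX Z)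
          moreover have "Cm ?Z \<subseteq> Jn (Cm ?X') (Cm (?X (p - 1)))" by (intro Cm_Jn D)
          moreover have "\<dots> \<subseteq> ?N"
            using Cm_decr[OF D] Jn_upper1 Jn_upper2 p1(1) unfolding D_Suc
            by (intro Jn_least N) (metis order_trans)+
          ultimately have "cm (v ^ p) g \<in> ?Q" using NQ by blast
          moreover have "Pw p (Cm (Cm (?X 0))) \<subseteq> ?Q"
            unfolding T using D_Suc Jn_upper2 by (metis One_nat_def)
          moreover have "(Cm ^^ p) (?X 0) \<subseteq> ?Q"
            using NQ Jn_upper2[of "?X p" ?X'] by (simp add: DD)
          ultimately show "t ^ p \<in> ?Q" using power_cm_congruence[OF D Q p _ _ v(1,2)] v(3) by blast
        qed
        moreover have "?M \<subseteq> ?N" by (rule Jn_least[OF order_refl Jn_upper2 N])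
        ultimately show ?thesis unfolding T by blast
      qed
      have step: "?X' \<subseteq> Jn ?X' (Cm (?V (p - 1)))" by (rule Jn_upper1)
      \<comment> \<open>The target of absorption. As \<open>?V (p - 1)\<close> lies in
        \<open>?Z\<close>, only the part \<open>?X (p - 1)\<close> of \<open>?Z\<close> has to be
        moved into \<open>?Y\<close>; \<open>XV\<close> rewrites it as commutators of
        W(i+1)^p.\<close>
      let ?Y = "Jn ?X' (Cm (?V (p - 1)))"
      have Y: "nsub ?Y" by (intro nJ)
      have "?X p \<subseteq> Cm (?V (p - 1))" using D_mono[of "Suc i" "Suc (Suc i)" p] p1(1) by (simp add: D_Suc)
      then have XpY: "?X p \<subseteq> ?Y" using Jn_upper2 by blast
      have PV: "Pw p (?V (p - 1)) \<subseteq> ?Y"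
      proof -
        have "Pw p (?V (p - 1)) \<subseteq> Pw p ?Z" by (intro Pw_mono VZ Z)
        also have "\<dots> \<subseteq> Jn ?X' (Pw p (?X (p - 1)))" by (intro Pw_Jn D)
        also have "\<dots> \<subseteq> ?Y"
        proof (intro Jn_least Y step)
          have "Pw p (?X (p - 1)) \<subseteq> Pw p (?X 1)" using p2 by (intro Pw_mono D_anti D) simp
          also have "\<dots> \<subseteq> Jn ?X' (?X p)" by (rule PX1)
          also have "\<dots> \<subseteq> ?Y" by (intro Jn_least Y step XpY)
          finally show "Pw p (?X (p - 1)) \<subseteq> ?Y" .
        qed
        finally show ?thesis .
      qed
      have "?X (p - 1) \<subseteq> ?Y"
      proof -
        have "?X (p - 1) \<subseteq> (Cm ^^ (p - 1)) (Pw p (?V 0))"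
          using Cm_funpow_mono[OF XV, of "p - 1"] nJ by (simp add: DD)
        also have "\<dots> \<subseteq> (Cm ^^ (p - 1)) (Jn (Pw p (?V 0)) {1})"
          by (intro Cm_funpow_mono nJ nsub_triv Jn_upper1)
        also have "\<dots> \<subseteq> ?Y"
        proof (rule CmJn[OF nsub_triv Y PV])
          have "?V (p - 1 + p - 1) \<subseteq> Cm (?V (p - 1))" unfolding D_Suc using p2 by (intro D_anti) simp
          then show "?V (p - 1 + p - 1) \<subseteq> ?Y" using Jn_upper2 by blast
          have "(Cm ^^ (p - 1)) {1} \<subseteq> (Cm ^^ 0) {1}" by (intro Cm_funpow_decr nsub_triv) simp
          then show "(Cm ^^ (p - 1)) {1} \<subseteq> ?Y" using nsubD(2)[OF Y] by auto
        qed
        finally show ?thesis .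
      qed
      then have "?Z \<subseteq> ?Y" by (intro Jn_least Y step)
      then have "?V (p - 1) \<subseteq> ?Y" using VZ by blast
      then show ?case by (rule nilpotent_absorb[OF D D DF])
    qed
    then show ?thesis using D_mono[of "Suc i" "Suc (Suc i)" 0] by auto
  qed
  then have "Jn (D (Suc i) 0) (D i (p - 1)) \<subseteq> D (Suc i) 0" by (intro Jn_least D) auto
  then show ?thesis using W2'[of i] by (auto simp: D0)
qed

end

section \<open>Exterior pairings\<close>

lemma mult_cancel: "a * x * b = a * y * b \<Longrightarrow> x = (y::'a::grp)"
proof -
  assume "a * x * b = a * y * b"
  then have "iv a * (a * x * b) * iv b = iv a * (a * y * b) * iv b" by simp
  then show "x = y" by (simp add: mult.assoc)
qed

lemma (in group) inv_mult_cancel: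
  "g \<in> carrier G \<Longrightarrow> x \<in> carrier G \<Longrightarrow> inv g \<otimes> (g \<otimes> x) = x"
  by (simp add: m_assoc[symmetric])

lemma (in group) conjg_closed [simp]:
  "g \<in> carrier G \<Longrightarrow> x \<in> carrier G \<Longrightarrow> conjg G g x \<in> carrier G"
  by (simp add: conjg_def)

lemma (in group) commg_closed [simp]:
  "g \<in> carrier G \<Longrightarrow> x \<in> carrier G \<Longrightarrow> commg G g x \<in> carrier G"
  by (simp add: commg_def)

lemma (in group) conjg_mult:
  "g \<in> carrier G \<Longrightarrow> x \<in> carrier G \<Longrightarrow> y \<in> carrier G \<Longrightarrow>
    conjg G g (x \<otimes> y) = conjg G g x \<otimes> conjg G g y"
  by (simp add: conjg_def m_assoc inv_mult_cancel)

lemma (in group) conjg_inv: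
  "g \<in> carrier G \<Longrightarrow> x \<in> carrier G \<Longrightarrow> conjg G g (inv x) = inv (conjg G g x)"
  by (simp add: conjg_def m_assoc inv_mult_group)

lemma (in group) conjg_pow:
  "g \<in> carrier G \<Longrightarrow> x \<in> carrier G \<Longrightarrow> conjg G g (x [^] (n::nat)) = conjg G g x [^] n"
  by (induction n) (simp_all add: conjg_mult, simp add: conjg_def)

lemma (in group) conjg_commg:
  "g \<in> carrier G \<Longrightarrow> x \<in> carrier G \<Longrightarrow> y \<in> carrier G \<Longrightarrow>
    conjg G g (commg G x y) = commg G (conjg G g x) (conjg G g y)"
  by (simp add: commg_def conjg_mult conjg_inv)

lemma (in group) conjg_generate:
  assumes g: "g \<in> carrier G" and S: "S \<subseteq> carrier G" and x: "x \<in> generate G S"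
    and conj: "\<And>s. s \<in> S \<Longrightarrow> conjg G g s \<in> S"
  shows "conjg G g x \<in> generate G S"
  using x
proof (induction rule: generate.induct)
  case one
  then show ?case using g by (simp add: conjg_def generate.one)
next
  case (incl h)
  then show ?case using conj by (simp add: generate.incl)
next
  case (inv h)
  then show ?case using conj[of h] subsetD[OF S, of h] g by (simp add: conjg_inv generate.inv)
next
  case (eng h1 h2)
  then show ?case using generate_in_carrier[OF S] g by (simp add: conjg_mult generate.eng)
qed

lemma (in group) lcs_carrier: "lcs G k \<subseteq> carrier G"
proof (induction k)
  case (Suc k)
  show ?case
  proof (cases k)
    case (Suc j)
    then have "{commg G x y | x y. x \<in> lcs G (Suc j) \<and> y \<in> carrier G} \<subseteq> carrier G"
      using Suc.IH by auto
    then show ?thesis using Suc by (simp add: generate_incl)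
  qed simp
qed simp

lemma (in group) lcs_conjg:
  "g \<in> carrier G \<Longrightarrow> x \<in> lcs G k \<Longrightarrow> conjg G g x \<in> lcs G k"
proof (induction k arbitrary: x)
  case (Suc k)
  show ?case
  proof (cases k)
    case (Suc j)
    let ?S = "{commg G x y | x y. x \<in> lcs G k \<and> y \<in> carrier G}"
    have "?S \<subseteq> carrier G" using subsetD[OF lcs_carrier[of k]] by auto
    moreover have "conjg G g s \<in> ?S" if s: "s \<in> ?S" for s
    proof -
      obtain a b where ab: "s = commg G a b" "a \<in> lcs G k" "b \<in> carrier G" using s by blast
      have "conjg G g s = commg G (conjg G g a) (conjg G g b)"
        using ab Suc.prems(1) subsetD[OF lcs_carrier ab(2)] by (simp add: conjg_commg)
      then show ?thesis
        using Suc.IH[OF Suc.prems(1) ab(2)] conjg_closed[OF Suc.prems(1) ab(3)] by blast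
    qed
    ultimately show ?thesis using conjg_generate[OF Suc.prems(1), of ?S x] Suc.prems(2) Suc by simp
  qed (use Suc in simp)
qed simp

lemma (in group) commg_lcs:
  assumes "g \<in> carrier G" "x \<in> lcs G (Suc k)"
  shows "commg G g x \<in> lcs G (Suc (Suc k))"
proof -
  let ?S = "{commg G x y | x y. x \<in> lcs G (Suc k) \<and> y \<in> carrier G}"
  have x: "x \<in> carrier G" using assms lcs_carrier by blast
  have "inv (commg G x g) \<in> generate G ?S" using assms by (intro generate.inv) auto
  moreover have "inv (commg G x g) = commg G g x"
    using x assms(1) by (simp add: commg_def inv_mult_group m_assoc)
  ultimately show ?thesis by simp
qed

text \<open>Only these relations of the exterior square enter the estimates, so the presentation is
  kept out until the end. The action of G appears as conjugation by \<sigma>.\<close>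

locale ext_pairing = group G for G :: "('g, 'h) monoid_scheme" (structure) +
  fixes \<sigma> :: "'g \<Rightarrow> 'a::grp" and w :: "'g \<Rightarrow> 'g \<Rightarrow> 'a"
  assumes \<sigma>_mult: "g \<in> carrier G \<Longrightarrow> h \<in> carrier G \<Longrightarrow> \<sigma> (g \<otimes> h) = \<sigma> g * \<sigma> h"
    and w_conj: "k \<in> carrier G \<Longrightarrow> g \<in> carrier G \<Longrightarrow> h \<in> carrier G \<Longrightarrow>
      w (conjg G k g) (conjg G k h) = \<sigma> k * w g h * iv (\<sigma> k)"
    and w_left: "g \<in> carrier G \<Longrightarrow> g' \<in> carrier G \<Longrightarrow> h \<in> carrier G \<Longrightarrow>
      w (g \<otimes> g') h = w (conjg G g g') (conjg G g h) * w g h"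
    and w_right: "g \<in> carrier G \<Longrightarrow> h \<in> carrier G \<Longrightarrow> h' \<in> carrier G \<Longrightarrow>
      w g (h \<otimes> h') = w g h * w (conjg G h g) (conjg G h h')"
    and w_self: "g \<in> carrier G \<Longrightarrow> w g g = 1"
begin

lemma \<sigma>_one [simp]: "\<sigma> \<one> = 1"
  using \<sigma>_mult[of \<one> \<one>] by (metis iv_mult_cancel left_iv one_closed r_one)

lemma \<sigma>_inv: "g \<in> carrier G \<Longrightarrow> \<sigma> (inv g) = iv (\<sigma> g)"
  using \<sigma>_mult[of g "inv g"] by (simp add: iv_unique)

lemma \<sigma>_commg: "g \<in> carrier G \<Longrightarrow> h \<in> carrier G \<Longrightarrow> \<sigma> (commg G g h) = cm (\<sigma> g) (\<sigma> h)"
  by (simp add: commg_def cm_def \<sigma>_mult \<sigma>_inv)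

lemma w_left': "g \<in> carrier G \<Longrightarrow> g' \<in> carrier G \<Longrightarrow> h \<in> carrier G \<Longrightarrow>
    w (g \<otimes> g') h = \<sigma> g * w g' h * iv (\<sigma> g) * w g h"
  by (simp add: w_left w_conj)

lemma w_right': "g \<in> carrier G \<Longrightarrow> h \<in> carrier G \<Longrightarrow> h' \<in> carrier G \<Longrightarrow>
    w g (h \<otimes> h') = w g h * \<sigma> h * w g h' * iv (\<sigma> h)"
  by (simp add: w_right w_conj mult.assoc)

lemma w_one: "g \<in> carrier G \<Longrightarrow> w g \<one> = 1" "g \<in> carrier G \<Longrightarrow> w \<one> g = 1"
  using w_right'[of g \<one> \<one>] w_left'[of \<one> \<one> g] by (simp_all, (metis iv_mult_cancel left_iv)+)

text \<open>Expand \<open>w\<close> at the pair (gh, gh), where it is 1: the diagonal terms drop out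
  and a conjugate of the product of the two values remains.\<close>

lemma w_swap: assumes "g \<in> carrier G" "h \<in> carrier G" shows "w h g = iv (w g h)"
proof -
  have "w (g \<otimes> h) (g \<otimes> h) = \<sigma> g * (w h g * w g h) * iv (\<sigma> g)"
    using assms w_self[of g] w_self[of h] w_left'[of g h "g \<otimes> h"]
    by (simp add: w_right' mult.assoc)
  also have "w (g \<otimes> h) (g \<otimes> h) = 1" using assms by (simp add: w_self)
  finally have "iv (\<sigma> g) * \<sigma> g = iv (\<sigma> g) * (\<sigma> g * (w h g * w g h) * iv (\<sigma> g)) * \<sigma> g"
    by simp
  then have "w h g * w g h = 1" by (simp add: mult.assoc)
  then show ?thesis by (metis iv_iv iv_unique)
qed

text \<open>Comparing the two expansions of \<open>w (gg') (hh')\<close>.\<close>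
lemma w_exchange:
  assumes "g \<in> carrier G" "g' \<in> carrier G" "h \<in> carrier G" "h' \<in> carrier G"
  shows "\<sigma> (g \<otimes> h) * w g' h' * iv (\<sigma> (g \<otimes> h)) * w g h =
    w g h * (\<sigma> (h \<otimes> g) * w g' h' * iv (\<sigma> (h \<otimes> g)))"
proof -
  have "w (g \<otimes> g') (h \<otimes> h') = \<sigma> g * w g' h * iv (\<sigma> g) *
      (\<sigma> (g \<otimes> h) * w g' h' * iv (\<sigma> (g \<otimes> h)) * w g h) * (\<sigma> h * w g h' * iv (\<sigma> h))"
    using assms w_left'[of g g' "h \<otimes> h'"] w_right'[of g' h h'] w_right'[of g h h']
    by (simp add: \<sigma>_mult mult.assoc)
  moreover have "w (g \<otimes> g') (h \<otimes> h') = \<sigma> g * w g' h * iv (\<sigma> g) *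
      (w g h * (\<sigma> (h \<otimes> g) * w g' h' * iv (\<sigma> (h \<otimes> g)))) * (\<sigma> h * w g h' * iv (\<sigma> h))"
    using assms w_right'[of "g \<otimes> g'" h h'] w_left'[of g g' h] w_left'[of g g' h']
    by (simp add: \<sigma>_mult mult.assoc)
  ultimately show ?thesis by (metis mult_cancel)
qed

definition "\<Gamma> = gen (\<sigma> ` carrier G \<union> {w g h | g h. g \<in> carrier G \<and> h \<in> carrier G})"

definition "pair_span R = gen {w g h | g h. (g, h) \<in> R}"

definition "E = pair_span (carrier G \<times> carrier G)"

lemma \<sigma>_\<Gamma>: "g \<in> carrier G \<Longrightarrow> \<sigma> g \<in> \<Gamma>" and w_\<Gamma>: "g \<in> carrier G \<Longrightarrow> h \<in> carrier G \<Longrightarrow> w g h \<in> \<Gamma>"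
  unfolding \<Gamma>_def by (auto intro!: gen_base)

sublocale op_group \<Gamma>
  by unfold_locales (simp add: \<Gamma>_def subgp_gen)

lemma w_pair_span: "(g, h) \<in> R \<Longrightarrow> w g h \<in> pair_span R"
  unfolding pair_span_def by (auto intro: gen_base)

lemma pair_span_least:
  "(\<And>g h. (g, h) \<in> R \<Longrightarrow> w g h \<in> N) \<Longrightarrow> subgp N \<Longrightarrow> pair_span R \<subseteq> N"
  unfolding pair_span_def by (rule gen_least) auto

lemma pair_span_mono: "R \<subseteq> R' \<Longrightarrow> pair_span R \<subseteq> pair_span R'"
  by (rule pair_span_least) (auto simp: pair_span_def intro: gen_base subgp_gen)

lemma subgp_conj: assumes "subgp N" shows "subgp {x. g * x * iv g \<in> N}"
  unfolding subgp_def
proof (intro conjI ballI)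
  fix x assume x: "x \<in> {x. g * x * iv g \<in> N}"
  { fix y assume "y \<in> {x. g * x * iv g \<in> N}"
    then have "(g * x * iv g) * (g * y * iv g) \<in> N" using x subgpD(2)[OF assms] by blast
    then show "x * y \<in> {x. g * x * iv g \<in> N}" by (simp add: mult.assoc) }
  have "iv (g * x * iv g) \<in> N" using x subgpD(3)[OF assms] by blast
  then show "iv x \<in> {x. g * x * iv g \<in> N}" by (simp add: mult.assoc)
qed (use subgpD(1)[OF assms] in simp)

text \<open>The Peiffer identity of the crossed module given by the commutator map: on
  \<open>E\<close>, conjugation by \<open>w g h\<close> agrees with the action of [g, h].\<close>

lemma w_conj_E:
  assumes "u \<in> E" "g \<in> carrier G" "h \<in> carrier G"
  shows "w g h * u * iv (w g h) = \<sigma> (commg G g h) * u * iv (\<sigma> (commg G g h))"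
proof -
  let ?c = "\<sigma> (commg G g h)"
  let ?A = "{u. w g h * u * iv (w g h) = ?c * u * iv ?c}"
  have "subgp ?A"
    unfolding subgp_def
  proof (intro conjI ballI)
    fix x assume x: "x \<in> ?A"
    { fix y assume y: "y \<in> ?A"
      have "w g h * (x * y) * iv (w g h) = (w g h * x * iv (w g h)) * (w g h * y * iv (w g h))"
        by (simp add: mult.assoc)
      also have "\<dots> = ?c * (x * y) * iv ?c" using x y by (simp add: mult.assoc)
      finally show "x * y \<in> ?A" by simp }
    have "w g h * iv x * iv (w g h) = iv (w g h * x * iv (w g h))" by (simp add: mult.assoc)
    also have "\<dots> = ?c * iv x * iv ?c" using x by (simp add: mult.assoc)
    finally show "iv x \<in> ?A" by simp
  qed simp
  moreover have "w a b \<in> ?A" if "a \<in> carrier G" "b \<in> carrier G" for a b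
  proof -
    \<comment> \<open>Conjugating the pair (a, b) by this element first cancels \<sigma>(hg) on the
      right side of \<open>w_exchange\<close>.\<close>
    let ?k = "inv (h \<otimes> g)"
    have k: "?k \<in> carrier G" using assms by simp
    have e: "w (conjg G ?k a) (conjg G ?k b) = iv (\<sigma> (h \<otimes> g)) * w a b * \<sigma> (h \<otimes> g)"
      using w_conj[OF k that] assms by (simp add: \<sigma>_inv)
    have "\<sigma> (g \<otimes> h) * (iv (\<sigma> (h \<otimes> g)) * w a b * \<sigma> (h \<otimes> g)) * iv (\<sigma> (g \<otimes> h)) * w g h = w g h * w a b"
      using w_exchange[OF assms(2) conjg_closed[OF k that(1)] assms(3) conjg_closed[OF k that(2)]]
      unfolding e by (simp add: mult.assoc)
    then have "w g h * w a b * iv (w g h) =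
        \<sigma> (g \<otimes> h) * (iv (\<sigma> (h \<otimes> g)) * w a b * \<sigma> (h \<otimes> g)) * iv (\<sigma> (g \<otimes> h))"
      by (metis mult.assoc mult_1_right right_iv)
    then show ?thesis using assms by (simp add: \<sigma>_commg \<sigma>_mult cm_def mult.assoc)
  qed
  ultimately have "E \<subseteq> ?A" unfolding E_def by (intro pair_span_least) auto
  then show ?thesis using assms(1) by blast
qed

text \<open>Invariance under G suffices, because \<open>w_conj_E\<close> reduces conjugation by the
  remaining generators of \<Gamma> to the action of commutators of G.\<close>

lemma nsub_pair_span:
  assumes R: "R \<subseteq> carrier G \<times> carrier G"
    and conj: "\<And>k g h. k \<in> carrier G \<Longrightarrow> (g, h) \<in> R \<Longrightarrow> (conjg G k g, conjg G k h) \<in> R"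
  shows "nsub (pair_span R)"
proof -
  let ?N = "pair_span R"
  have N: "subgp ?N" by (simp add: pair_span_def subgp_gen)
  have NE: "?N \<subseteq> E" unfolding E_def by (rule pair_span_mono[OF R])
  have \<sigma>: "\<sigma> k * x * iv (\<sigma> k) \<in> ?N" if k: "k \<in> carrier G" and x: "x \<in> ?N" for k x
  proof -
    have "?N \<subseteq> {x. \<sigma> k * x * iv (\<sigma> k) \<in> ?N}"
    proof (rule pair_span_least)
      fix g h assume gh: "(g, h) \<in> R"
      then show "w g h \<in> {x. \<sigma> k * x * iv (\<sigma> k) \<in> ?N}"
        using w_conj[OF k] w_pair_span[OF conj[OF k gh]] R by auto
    qed (rule subgp_conj[OF N])
    then show ?thesis using x by blast
  qed
  have w: "w g h * x * iv (w g h) \<in> ?N" if "g \<in> carrier G" "h \<in> carrier G" "x \<in> ?N" for g h x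
    using w_conj_E[of x g h] \<sigma>[of "commg G g h" x] that NE by auto
  \<comment> \<open>Both conjugations are demanded so that the set is closed under
    \<open>iv\<close>.\<close>
  let ?C = "{\<gamma>. \<forall>x\<in>?N. \<gamma> * x * iv \<gamma> \<in> ?N \<and> iv \<gamma> * x * \<gamma> \<in> ?N}"
  have "subgp ?C"
    unfolding subgp_def
  proof (intro conjI ballI)
    fix \<gamma> assume a: "\<gamma> \<in> ?C"
    { fix \<delta> assume b: "\<delta> \<in> ?C"
      have "\<gamma> * \<delta> * x * iv (\<gamma> * \<delta>) \<in> ?N \<and> iv (\<gamma> * \<delta>) * x * (\<gamma> * \<delta>) \<in> ?N" if x: "x \<in> ?N" for x
      proof -
        have "\<gamma> * (\<delta> * x * iv \<delta>) * iv \<gamma> \<in> ?N" "iv \<delta> * (iv \<gamma> * x * \<gamma>) * \<delta> \<in> ?N"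
          using a b x by blast+
        then show ?thesis by (simp add: mult.assoc)
      qed
      then show "\<gamma> * \<delta> \<in> ?C" by blast }
    show "iv \<gamma> \<in> ?C" using a by simp
  qed simp
  moreover have "\<sigma> k \<in> ?C" if "k \<in> carrier G" for k
    using \<sigma>[OF that] \<sigma>[of "inv k"] that by (simp add: \<sigma>_inv)
  moreover have "w g h \<in> ?C" if "g \<in> carrier G" "h \<in> carrier G" for g h
    using w[OF that] w[OF that(2,1)] w_swap[OF that] by simp
  ultimately have "\<Gamma> \<subseteq> ?C" unfolding \<Gamma>_def by (intro gen_least) auto
  moreover have "?N \<subseteq> \<Gamma>" using R w_\<Gamma> by (intro pair_span_least subgp_\<Gamma>) auto
  ultimately show ?thesis using N unfolding nsub_def by blast
qed

text \<open>In the nonabelian tensor square this is the identity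
  \<open>h \<otimes> [g,x] = \<^sup>h(g \<otimes> x) (g \<otimes> x)\<inverse>\<close>.\<close>
lemma w_commg:
  assumes h: "h \<in> carrier G" and g: "g \<in> carrier G" and x: "x \<in> carrier G"
  shows "w h (commg G g x) = cm (\<sigma> h) (w g x)"
proof -
  have wE: "iv (w h x) \<in> E"
    unfolding E_def pair_span_def using h x by (intro gen_iv gen_base) auto
  have gx: "commg G g x = conjg G g x \<otimes> inv x" using g x by (simp add: commg_def conjg_def)
  have inv: "w h (inv x) = iv (\<sigma> x) * iv (w h x) * \<sigma> x"
  proof -
    have "w h x * (\<sigma> x * w h (inv x) * iv (\<sigma> x)) = 1"
      using w_right'[of h x "inv x"] h x by (simp add: w_one mult.assoc)
    then have "iv (w h x) = \<sigma> x * w h (inv x) * iv (\<sigma> x)" by (rule iv_unique)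
    then show ?thesis by (simp add: mult.assoc)
  qed
  have "w h (commg G g x) = w h (conjg G g x) *
      (\<sigma> (conjg G g x) * (iv (\<sigma> x) * iv (w h x) * \<sigma> x) * iv (\<sigma> (conjg G g x)))"
    unfolding gx using h g x by (simp add: w_right' inv mult.assoc)
  also have "\<sigma> (conjg G g x) * (iv (\<sigma> x) * iv (w h x) * \<sigma> x) * iv (\<sigma> (conjg G g x)) =
      \<sigma> (commg G g x) * iv (w h x) * iv (\<sigma> (commg G g x))"
    using g x by (simp add: \<sigma>_commg conjg_def \<sigma>_mult \<sigma>_inv cm_def mult.assoc)
  also have "\<dots> = w g x * iv (w h x) * iv (w g x)"
    using w_conj_E[OF wE g x] by simp
  finally have 1: "w h (commg G g x) = w h (conjg G g x) * w g x * iv (w h x) * iv (w g x)"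
    by (simp add: mult.assoc)
  \<comment> \<open>The factor \<open>w h (conjg G g x) * w g x\<close> of \<open>1\<close> is one
    expansion of \<open>w (h \<otimes> g) x\<close>; the other comes from splitting off
    \<open>h\<close> on the left.\<close>
  have "h \<otimes> g = g \<otimes> (inv g \<otimes> h \<otimes> g)" using h g by (simp add: m_assoc[symmetric])
  then have "w (h \<otimes> g) x = \<sigma> g * w (inv g \<otimes> h \<otimes> g) x * iv (\<sigma> g) * w g x"
    using w_left'[of g "inv g \<otimes> h \<otimes> g" x] g h x by simp
  also have "\<sigma> g * w (inv g \<otimes> h \<otimes> g) x * iv (\<sigma> g) = w h (conjg G g x)"
  proof -
    have "g \<otimes> (inv g \<otimes> h \<otimes> g) = h \<otimes> g" using h g by (simp add: m_assoc[symmetric])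
    then have "conjg G g (inv g \<otimes> h \<otimes> g) = h" using g h by (simp add: conjg_def m_assoc)
    then show ?thesis using w_conj[of g "inv g \<otimes> h \<otimes> g" x] g h x by simp
  qed
  finally have "w h (conjg G g x) * w g x = \<sigma> h * w g x * iv (\<sigma> h) * w h x"
    using w_left'[OF h g x] by simp
  with 1 show ?thesis by (simp add: cm_def mult.assoc)
qed

text \<open>\<open>g \<mapsto> w g h\<close> is a crossed homomorphism, so \<open>g \<mapsto> (w g h)\<inverse> \<sigma>(g)\<close> is a homomorphism.\<close>
lemma w_pow:
  assumes x: "x \<in> carrier G" and h: "h \<in> carrier G"
  shows "(iv (w x h) * \<sigma> x) ^ n = iv (w (x [^] n) h) * \<sigma> (x [^] n)"
proof (induction n)
  case (Suc n)
  have "x [^] Suc n = x \<otimes> x [^] n" using x by (metis nat_pow_Suc2)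
  then show ?case using Suc x h by (simp add: w_left' \<sigma>_mult mult.assoc del: nat_pow_Suc)
qed (use h in \<open>simp add: w_one\<close>)

lemma \<sigma>_pow: "x \<in> carrier G \<Longrightarrow> \<sigma> (x [^] (n::nat)) = \<sigma> x ^ n"
  by (induction n) (simp_all add: \<sigma>_mult power_commutes)

text \<open>Shifted by one: \<open>F k\<close> is spanned by G \<and> \<gamma>(k+1), so that
  \<open>F 0\<close> is all of \<open>E\<close>.\<close>

definition "F k = pair_span {(g, x). g \<in> carrier G \<and> x \<in> lcs G (Suc k)}"

text \<open>Indexed by the exponent itself: the i-th subgroup of the chain is
  \<open>W (p ^ i)\<close>.\<close>

definition "W q = pair_span {(y [^] q, h) | y h. y \<in> carrier G \<and> h \<in> carrier G}" for q :: nat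

lemma nsub_F: "nsub (F k)"
  unfolding F_def using lcs_carrier[of "Suc k"] lcs_conjg[where k = "Suc k"]
  by (intro nsub_pair_span) (auto simp del: lcs.simps)

lemma nsub_W: "nsub (W q)"
  unfolding W_def by (intro nsub_pair_span) (auto simp: conjg_pow)

lemma F_0: "F 0 = E"
  unfolding F_def E_def by (rule arg_cong[where f = pair_span]) auto

lemma W_1: "W 1 = E"
proof -
  have "{(y [^] (1::nat), h) | y h. y \<in> carrier G \<and> h \<in> carrier G} = carrier G \<times> carrier G"
    by force
  then show ?thesis by (simp only: W_def E_def)
qed

text \<open>By \<open>w_commg\<close>, commuting a generator \<open>w g x\<close> with \<sigma>(h)
  gives w at (h, [g, x]), one step deeper in the series; the generators \<open>w a b\<close> of
  \<Gamma> act on \<open>E\<close> like \<sigma> of a commutator.\<close>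

lemma Cm_F: "Cm (F k) \<subseteq> F (Suc k)"
proof -
  let ?S = "{w g x | g x. g \<in> carrier G \<and> x \<in> lcs G (Suc k)}"
  have S: "?S \<subseteq> \<Gamma>" using w_\<Gamma> lcs_carrier[of "Suc k"] by (auto simp del: lcs.simps)
  have "F k = gen ?S" by (simp add: F_def pair_span_def)
  also have "\<dots> \<subseteq> ncl ?S" using nsubD(1)[OF nsub_ncl[OF S]] by (intro gen_least ncl_subset)
  finally have "Cm (F k) \<subseteq> Cm (ncl ?S)" by (intro Cm_mono nsub_ncl S)
  also have "\<dots> \<subseteq> F (Suc k)"
  proof (rule Cm_ncl_least[OF nsub_F S])
    fix s \<gamma> assume "s \<in> ?S" and \<gamma>: "\<gamma> \<in> \<Gamma>"
    then obtain g x where s: "s = w g x" "g \<in> carrier G" "x \<in> lcs G (Suc k)" by auto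
    have x: "x \<in> carrier G" using lcs_carrier s by blast
    have \<sigma>: "cm (\<sigma> h) s \<in> F (Suc k)" if "h \<in> carrier G" for h
      unfolding s(1) w_commg[OF that s(2) x, symmetric] F_def
      using that commg_lcs[OF s(2,3)] by (intro w_pair_span) (auto simp del: lcs.simps)
    have w: "cm (w a b) s \<in> F (Suc k)" if ab: "a \<in> carrier G" "b \<in> carrier G" for a b
    proof -
      have "s \<in> E" unfolding E_def s(1) using s x by (intro w_pair_span) auto
      then have "cm (w a b) s = cm (\<sigma> (commg G a b)) s"
        unfolding cm_def using w_conj_E[OF _ ab] by simp
      then show ?thesis using \<sigma>[of "commg G a b"] ab by simp
    qed
    have "cm \<gamma> s \<in> F (Suc k)"
    proof (rule commuting_gen[OF op_group_axioms nsub_F])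
      show "\<gamma> \<in> gen (\<sigma> ` carrier G \<union> {w g h | g h. g \<in> carrier G \<and> h \<in> carrier G})"
        using \<gamma> by (simp add: \<Gamma>_def)
      show "s \<in> \<Gamma>" using s x w_\<Gamma> by simp
    qed (use \<sigma> w \<sigma>_\<Gamma> w_\<Gamma> in auto)
    then show "cm s \<gamma> \<in> F (Suc k)" using nsubD(4)[OF nsub_F, of "cm \<gamma> s"] by (simp add: iv_cm)
  qed
  finally show ?thesis .
qed

lemma F_triv: assumes "lcs G (Suc c) = {\<one>}" shows "F c = {1}"
proof
  show "F c \<subseteq> {1}"
    unfolding F_def assms by (rule pair_span_least) (auto simp: w_one nsubD(1)[OF nsub_triv])
  show "{1} \<subseteq> F c" using nsubD(2)[OF nsub_F] by simp
qed

lemma W_decr: "W (q * r) \<subseteq> W q"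
  unfolding W_def
proof (rule pair_span_mono, rule subsetI)
  fix x assume "x \<in> {(y [^] (q * r), h) | y h. y \<in> carrier G \<and> h \<in> carrier G}"
  then obtain y h where y: "x = (y [^] (q * r), h)" "y \<in> carrier G" "h \<in> carrier G" by blast
  have "y [^] (q * r) = (y [^] r) [^] q" by (simp only: nat_pow_pow[OF y(2)] mult.commute)
  with y(1) have "x = ((y [^] r) [^] q, h)" by simp
  then show "x \<in> {(y [^] q, h) | y h. y \<in> carrier G \<and> h \<in> carrier G}"
    using y(3) nat_pow_closed[OF y(2)] by blast
qed

text \<open>The congruence for \<open>(a \<sigma>(x))\<^sup>p\<close> with \<open>a = (w x h)\<inverse>\<close>, a power that \<open>w_pow\<close> evaluates.\<close>
lemma W_power_congruence:
  assumes p: "Factorial_Ring.prime p" and Z: "nsub Z"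
    and PZ: "Pw p (Cm (W q)) \<subseteq> Z" and CZ: "(Cm ^^ (p - 1)) (W q) \<subseteq> Z"
    and y: "y \<in> carrier G" and h: "h \<in> carrier G"
  shows "w (y [^] (q * p)) h \<in> Z \<longleftrightarrow> w (y [^] q) h ^ p \<in> Z"
proof -
  define x where "x = y [^] q"
  have x: "x \<in> carrier G" using y by (simp add: x_def)
  define a b where "a = iv (w x h)" and "b = iv (w (x [^] p) h)"
  have xp: "x [^] p = y [^] (q * p)" using y by (simp add: x_def nat_pow_pow)
  have "w x h \<in> W q" unfolding W_def x_def using y h by (intro w_pair_span) blast
  then have a: "a \<in> W q" unfolding a_def by (rule nsubD(4)[OF nsub_W])
  have "(a * \<sigma> x) ^ p = b * \<sigma> x ^ p"
    using w_pow[OF x h, of p] x by (simp add: a_def b_def \<sigma>_pow)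
  with power_mult_congruence[OF nsub_W Z p PZ CZ a \<sigma>_\<Gamma>[OF x]]
  have "iv (\<sigma> x ^ p) * (iv a ^ p * b) * \<sigma> x ^ p \<in> Z"
    by (simp add: iv_power mult.assoc)
  from nsubD(5)[OF Z this subgp_power[OF subgp_\<Gamma> \<sigma>_\<Gamma>[OF x]], of p]
  have ab: "iv (a ^ p) * b \<in> Z" by (simp add: mult.assoc flip: iv_power)
  have "b \<in> Z \<longleftrightarrow> a ^ p \<in> Z"
  proof
    assume "b \<in> Z"
    then have "b * iv (iv (a ^ p) * b) \<in> Z" using nsubD(3,4)[OF Z] ab by blast
    then show "a ^ p \<in> Z" by (simp add: mult.assoc)
  next
    assume "a ^ p \<in> Z"
    then have "a ^ p * (iv (a ^ p) * b) \<in> Z" using nsubD(3)[OF Z] ab by blast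
    then show "b \<in> Z" by simp
  qed
  moreover have "iv u \<in> Z \<longleftrightarrow> u \<in> Z" for u using nsubD(4)[OF Z] by (metis iv_iv)
  ultimately show ?thesis by (simp add: a_def b_def xp flip: iv_power) (simp add: x_def)
qed

lemma W_power1:
  assumes p: "Factorial_Ring.prime p"
  shows "W (q * p) \<subseteq> Jn (Pw p (W q)) ((Cm ^^ (p - 1)) (W q))" (is "_ \<subseteq> ?Z")
proof -
  have Z: "nsub ?Z" by (intro nsub_Jn nsub_Pw nsub_Cm_funpow nsub_W)
  show ?thesis
    unfolding W_def[of "q * p"]
  proof (rule pair_span_least[OF _ nsubD(1)[OF Z]])
    fix g h assume "(g, h) \<in> {(y [^] (q * p), h) | y h. y \<in> carrier G \<and> h \<in> carrier G}"
    then obtain y where y: "g = y [^] (q * p)" "y \<in> carrier G" "h \<in> carrier G" by auto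
    have "w (y [^] q) h \<in> W q" unfolding W_def using y by (intro w_pair_span) blast
    then have "w (y [^] q) h ^ p \<in> ?Z" using Pw_mem Jn_upper1 by blast
    moreover have "Pw p (Cm (W q)) \<subseteq> ?Z"
      using Pw_mono[OF Cm_decr[OF nsub_W] nsub_W, of p q] Jn_upper1 by blast
    ultimately show "w g h \<in> ?Z"
      using W_power_congruence[OF p Z _ Jn_upper2 y(2,3)] y(1) by blast
  qed
qed

text \<open>The congruence controls p-th powers of the generators only, and modulo powers of
  \<open>Cm (W q)\<close>; nilpotency, through \<open>Pw_subset_of_generators\<close>, extends it to
  all of \<open>W q\<close>.\<close>

lemma W_power2:
  assumes p: "Factorial_Ring.prime p"
    and nil: "lcs G (Suc c) = {\<one>}"
  shows "Pw p (W q) \<subseteq> Jn (W (q * p)) ((Cm ^^ (p - 1)) (W q))"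
proof -
  interpret nilpotent_action \<Gamma> F c
    by unfold_locales (auto intro: nsub_F subsetD[OF Cm_F] simp: F_triv[OF nil] simp del: lcs.simps)
  let ?T = "{w (y [^] q) h | y h. y \<in> carrier G \<and> h \<in> carrier G}"
  have T: "?T \<subseteq> \<Gamma>" using w_\<Gamma> by auto
  have WT: "W q = ncl ?T"
  proof
    have "W q = gen ?T" unfolding W_def pair_span_def by (rule arg_cong[where f = gen]) auto
    then show "W q \<subseteq> ncl ?T" using nsubD(1)[OF nsub_ncl[OF T]] gen_least[OF ncl_subset, of ?T] by simp
    show "ncl ?T \<subseteq> W q" by (intro ncl_least nsub_W) (auto simp: W_def intro!: w_pair_span)
  qed
  let ?M = "Jn (W (q * p)) ((Cm ^^ (p - 1)) (W q))"
  let ?Z = "Jn ?M (Pw p (Cm (W q)))"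
  have Z: "nsub ?Z" by (intro nsub_Jn nsub_Pw nsub_Cm nsub_Cm_funpow nsub_W)
  have "Pw p (ncl ?T) \<subseteq> ?M"
  proof (rule Pw_subset_of_generators[OF p T nsub_W])
    show "ncl ?T \<subseteq> F 0" using W_decr[of 1 q] W_1 by (simp add: F_0 WT)
    show "?M = Jn (W (q * p)) ((Cm ^^ (p - 1)) (ncl ?T))" by (simp add: WT)
    fix t assume "t \<in> ?T"
    then obtain y h where t: "t = w (y [^] q) h" "y \<in> carrier G" "h \<in> carrier G" by auto
    have "w (y [^] (q * p)) h \<in> W (q * p)" unfolding W_def using t by (intro w_pair_span) blast
    then have "w (y [^] (q * p)) h \<in> ?Z" using Jn_upper1 by blast
    moreover have "(Cm ^^ (p - 1)) (W q) \<subseteq> ?Z" using Jn_upper1 Jn_upper2 by blast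
    ultimately have "t ^ p \<in> ?Z"
      using W_power_congruence[OF p Z Jn_upper2 _ t(2,3)] t(1) by blast
    then show "t ^ p \<in> Jn ?M (Pw p (Cm (ncl ?T)))" by (simp add: WT)
  qed
  then show ?thesis by (simp add: WT)
qed

lemma w_power_subgroup:
  assumes x: "x \<in> power_subgroup G q" and g: "g \<in> carrier G"
  shows "w g x \<in> W q"
proof -
  let ?S = "{x [^] q | x. x \<in> carrier G}"
  have S: "?S \<subseteq> carrier G" by auto
  note D = nsubD[OF nsub_W[of q]]
  have base: "w g (y [^] q) \<in> W q" if "g \<in> carrier G" "y \<in> carrier G" for g y
  proof -
    have "w (y [^] q) g \<in> W q" unfolding W_def using that by (intro w_pair_span) blast
    then show ?thesis using D(4) w_swap[of "y [^] q" g] that by simp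
  qed
  have "x \<in> generate G ?S" using x by (simp add: power_subgroup_def)
  then show ?thesis
  proof (induction rule: generate.induct)
    case one
    then show ?case using g D(2) by (simp add: w_one)
  next
    case (incl h)
    then show ?case using base g by auto
  next
    case (inv h)
    then obtain y where "h = y [^] q" "y \<in> carrier G" by auto
    then show ?case using base[OF g, of "inv y"] by (simp add: nat_pow_inv)
  next
    case (eng h1 h2)
    have h: "h1 \<in> carrier G" "h2 \<in> carrier G" using generate_in_carrier[OF S] eng by blast+
    have "w g (h1 \<otimes> h2) = w g h1 * (\<sigma> h1 * w g h2 * iv (\<sigma> h1))"
      using w_right'[OF g h] by (simp add: mult.assoc)
    then show ?case using D(3)[OF eng.IH(1) D(5)[OF eng.IH(2) \<sigma>_\<Gamma>[OF h(1)]]] by simp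
  qed
qed

theorem power_eq_one:
  assumes p: "Factorial_Ring.prime p" and nil: "lcs G (Suc c) = {\<one>}"
    and exp: "\<And>y. y \<in> carrier G \<Longrightarrow> y [^] (p ^ e) = \<one>"
    and hyp: "(p \<ge> 3 \<and> lcs G (p - 1) \<subseteq> power_subgroup G p) \<or> lcs G p \<subseteq> power_subgroup G (p ^ 2)"
    and t: "t \<in> E"
  shows "t ^ (p ^ e) = 1"
proof -
  interpret nilpotent_action \<Gamma> F c
    by unfold_locales (auto intro: nsub_F subsetD[OF Cm_F] simp: F_triv[OF nil] simp del: lcs.simps)
  \<comment> \<open>The k-fold commutator of \<open>E\<close> reaches \<gamma>(k+1), so the
    hypotheses on \<gamma>(p-1) and \<gamma>(p) speak of p - 2 and p - 1 commutators.\<close>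
  have F_bound: "(Cm ^^ k) (W (p ^ 0)) \<subseteq> W q" if "lcs G (Suc k) \<subseteq> power_subgroup G q" for k q
  proof -
    have "(Cm ^^ k) (W (p ^ 0)) \<subseteq> F k" using funpow_Cm_F[of "W 1" k] W_1 F_0 by simp
    also have "F k \<subseteq> W q"
      unfolding F_def using that w_power_subgroup nsubD(1)[OF nsub_W]
      by (intro pair_span_least) (auto simp del: lcs.simps)
    finally show ?thesis .
  qed
  have start: "(p \<ge> 2 \<and> (Cm ^^ (p - 2)) (W (p ^ 0)) \<subseteq> W (p ^ 1)) \<or>
      (Cm ^^ (p - 1)) (W (p ^ 0)) \<subseteq> W (p ^ 2)"
    using hyp
  proof
    assume h: "p \<ge> 3 \<and> lcs G (p - 1) \<subseteq> power_subgroup G p"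
    then have "Suc (p - 2) = p - 1" by auto
    then have "lcs G (Suc (p - 2)) \<subseteq> power_subgroup G p" using h by (simp only:)
    from F_bound[OF this] show ?thesis using h by simp
  next
    assume "lcs G p \<subseteq> power_subgroup G (p ^ 2)"
    moreover have "Suc (p - 1) = p" using prime_gt_0_nat[OF p] by simp
    ultimately have "lcs G (Suc (p - 1)) \<subseteq> power_subgroup G (p ^ 2)" by (simp only:)
    from F_bound[OF this] show ?thesis by simp
  qed
  have step: "Pw p (W (p ^ i)) \<subseteq> W (p ^ Suc i)" for i
  proof (rule power_chain[OF p, of "\<lambda>i. W (p ^ i)"])
    show "nsub (W (p ^ i))" for i by (rule nsub_W)
    show "W (p ^ 0) \<subseteq> F 0" using W_1 F_0 by simp
    show "W (p ^ Suc i) \<subseteq> W (p ^ i)" for i using W_decr[of "p ^ i" p] by (simp add: mult.commute)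
    show "W (p ^ Suc i) \<subseteq> Jn (Pw p (W (p ^ i))) ((Cm ^^ (p - 1)) (W (p ^ i)))" for i
      using W_power1[OF p, of "p ^ i"] by (simp add: mult.commute)
    show "Pw p (W (p ^ i)) \<subseteq> Jn (W (p ^ Suc i)) ((Cm ^^ (p - 1)) (W (p ^ i)))" for i
      using W_power2[OF p nil, of "p ^ i"] by (simp add: mult.commute)
    show "p \<ge> 2 \<and> (Cm ^^ (p - 2)) (W (p ^ 0)) \<subseteq> W (p ^ 1) \<or>
        (Cm ^^ (p - 1)) (W (p ^ 0)) \<subseteq> W (p ^ 2)"
      by (rule start)
  qed
  have "t ^ (p ^ i) \<in> W (p ^ i)" for i
  proof (induction i)
    case 0
    then show ?case using t W_1 by simp
  next
    case (Suc i)
    then have "(t ^ (p ^ i)) ^ p \<in> W (p ^ Suc i)" using step[of i] Pw_mem by blast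
    moreover have "t ^ (p ^ Suc i) = (t ^ (p ^ i)) ^ p" by (simp add: mult.commute flip: power_mult)
    ultimately show ?case by simp
  qed
  moreover have "W (p ^ e) \<subseteq> {1}"
    unfolding W_def by (rule pair_span_least) (auto simp: exp w_one nsubD(1)[OF nsub_triv])
  ultimately show ?thesis by blast
qed

end

section \<open>Nilpotency of finite p-groups\<close>

text \<open>Orbit sizes are powers of p; without a fixed point all would be divisible by p. The
  invariant subset \<open>E0\<close> is separate from the set acted upon, which will be the power
  set of the group with only some cosets of interest.\<close>

lemma (in group_action) p_group_fixed_point:
  assumes p: "Factorial_Ring.prime p" and G: "order G = p ^ n"
    and E0: "E0 \<subseteq> E" "finite E0" "\<not> p dvd card E0"
    and closed: "\<And>g x. g \<in> carrier G \<Longrightarrow> x \<in> E0 \<Longrightarrow> \<phi> g x \<in> E0"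
  shows "\<exists>x\<in>E0. \<forall>g\<in>carrier G. \<phi> g x = x"
proof (rule ccontr)
  assume neg: "\<not> ?thesis"
  have self: "x \<in> orbit G \<phi> x" if "x \<in> E0" for x using that E0 orbit_refl by blast
  have sub: "orbit G \<phi> x \<subseteq> E0" if "x \<in> E0" for x
    using closed that by (auto simp: orbit_def)
  have eq: "orbit G \<phi> y \<subseteq> orbit G \<phi> x" if "x \<in> E0" "y \<in> orbit G \<phi> x" for x y
  proof
    fix z assume z: "z \<in> orbit G \<phi> y"
    have "y \<in> E0" "z \<in> E0" using that z sub by blast+
    then show "z \<in> orbit G \<phi> x" using orbit_trans[of x y z] that z E0 by blast
  qed
  have "p dvd card (\<Union> (orbit G \<phi> ` E0))"
  proof (rule dvd_partition)
    show "finite (\<Union> (orbit G \<phi> ` E0))"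
      using sub E0(2) finite_subset[of "\<Union> (orbit G \<phi> ` E0)" E0] by blast
    show "\<forall>c\<in>orbit G \<phi> ` E0. p dvd card c"
    proof safe
      fix x assume x: "x \<in> E0"
      have "card (orbit G \<phi> x) * card (stabilizer G \<phi> x) = p ^ n"
        using orbit_stabilizer_theorem[of x] x E0 G by auto
      then have "card (orbit G \<phi> x) dvd p ^ n" by (metis dvd_triv_left)
      then obtain k where k: "card (orbit G \<phi> x) = p ^ k"
        using divides_primepow_nat[OF p] by auto
      show "p dvd card (orbit G \<phi> x)"
      proof (cases k)
        case 0
        then obtain y where "orbit G \<phi> x = {y}" using k card_1_singletonE by auto
        then have "orbit G \<phi> x = {x}" using self[OF x] by auto
        then have "\<phi> g x = x" if "g \<in> carrier G" for g
          using that by (auto simp: orbit_def)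
        then show ?thesis using neg x by blast
      qed (use k in simp)
    qed
    show "\<forall>c1\<in>orbit G \<phi> ` E0. \<forall>c2\<in>orbit G \<phi> ` E0. c1 \<noteq> c2 \<longrightarrow> c1 \<inter> c2 = {}"
    proof (intro ballI impI, rule ccontr)
      fix c1 c2 assume c: "c1 \<in> orbit G \<phi> ` E0" "c2 \<in> orbit G \<phi> ` E0" "c1 \<noteq> c2" "c1 \<inter> c2 \<noteq> {}"
      then obtain x y z where h: "x \<in> E0" "y \<in> E0" "c1 = orbit G \<phi> x" "c2 = orbit G \<phi> y"
        "z \<in> orbit G \<phi> x" "z \<in> orbit G \<phi> y" by auto
      have z: "z \<in> E0" using sub h by blast
      have "x \<in> orbit G \<phi> z" "y \<in> orbit G \<phi> z" using orbit_sym h z E0(1) by blast+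
      then have "c1 = orbit G \<phi> z" "c2 = orbit G \<phi> z"
        using eq[OF z] eq[OF h(1,5)] eq[OF h(2,6)] h by blast+
      then show False using c by simp
    qed
  qed
  moreover have "\<Union> (orbit G \<phi> ` E0) = E0" using self sub by blast
  ultimately show False using E0 by simp
qed

context group
begin

text \<open>The centre of the p-group G/K is nontrivial: G permutes the nontrivial cosets by
  conjugation, their number is congruent to -1 modulo p, and a fixed coset is central.\<close>

lemma p_group_central_coset:
  assumes p: "Factorial_Ring.prime p" and G: "order G = p ^ n" and fin: "finite (carrier G)"
    and K: "K \<lhd> G" "K \<noteq> carrier G"
  shows "\<exists>g\<in>carrier G - K. \<forall>x\<in>carrier G. commg G x g \<in> K"
proof -
  interpret K: normal K G by (rule K)
  let ?\<phi> = "\<lambda>g. \<lambda>H \<in> {H. H \<subseteq> carrier G}. g <# H #> inv g"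
  interpret group_action G "{H. H \<subseteq> carrier G}" ?\<phi>
    by (rule action_by_conjugation_on_power_set)
  let ?E = "rcosets K - {K}"
  have Kc: "K \<in> rcosets K" using K.subgroup_axioms by (metis coset_join2 one_closed rcosetsI K.subset K.one_closed)
  have finR: "finite (rcosets K)" unfolding RCOSETS_def using fin by simp
  have conj: "g <# (K #> a) #> inv g = K #> conjg G g a" if "g \<in> carrier G" "a \<in> carrier G" for g a
  proof -
    have "g <# (K #> a) = (g <# K) #> a" using that K.subset by (simp add: coset_assoc)
    also have "g <# K = K #> g" using K.coset_eq that by simp
    finally show ?thesis using that K.subset by (simp add: coset_mult_assoc conjg_def r_coset_subset_G)
  qed
  have ndvd: "\<not> p dvd card ?E"
  proof
    assume d: "p dvd card ?E"
    have "card (rcosets K) * card K = p ^ n" using lagrange[OF K.subgroup_axioms] G by simp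
    then have "card (rcosets K) dvd p ^ n" by (metis dvd_triv_left)
    then obtain k where k: "card (rcosets K) = p ^ k" using divides_primepow_nat[OF p] by auto
    have "k \<noteq> 0"
    proof
      assume "k = 0"
      then have "card K = order G" using k lagrange[OF K.subgroup_axioms] by simp
      then have "K = carrier G" using card_subset_eq[OF fin K.subset] by (simp add: order_def)
      then show False using K by simp
    qed
    then have "p dvd card (rcosets K)" using k by simp
    moreover have "card (rcosets K) = Suc (card ?E)"
      using finR Kc by (metis card_Suc_Diff1)
    ultimately have "p dvd 1" using d by (metis Suc_eq_plus1 dvd_add_right_iff)
    then show False using p by simp
  qed
  have sub: "?E \<subseteq> {H. H \<subseteq> carrier G}" using rcosets_part_G[OF K.subgroup_axioms] by blast
  have closed: "?\<phi> g C \<in> ?E" if g: "g \<in> carrier G" and C: "C \<in> ?E" for g C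
  proof -
    obtain a where a: "a \<in> carrier G" "C = K #> a" using C by (auto simp: RCOSETS_def)
    have Cs: "C \<subseteq> carrier G" using a K.subset by (simp add: r_coset_subset_G)
    have eq: "?\<phi> g C = K #> conjg G g a" using conj[OF g a(1)] a Cs by simp
    have "K #> conjg G g a \<noteq> K"
    proof
      assume "K #> conjg G g a = K"
      then have "conjg G g a \<in> K"
        using rcos_self[OF conjg_closed[OF g a(1)] K.subgroup_axioms] by simp
      then have "inv g \<otimes> conjg G g a \<otimes> g \<in> K" using K.inv_op_closed1 g by blast
      moreover have "inv g \<otimes> conjg G g a \<otimes> g = a"
        using g a by (simp add: conjg_def m_assoc inv_mult_cancel)
      ultimately have "a \<in> K" by simp
      then have "C = K" using a coset_join2 K.subgroup_axioms by simp
      then show False using C by simp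
    qed
    then show ?thesis unfolding eq using K.subset g a by (auto intro!: rcosetsI)
  qed
  have "\<exists>C\<in>?E. \<forall>g\<in>carrier G. ?\<phi> g C = C"
    by (rule p_group_fixed_point[OF p G sub _ ndvd closed]) (use finR in simp_all)
  then obtain C where C: "C \<in> ?E" "\<And>g. g \<in> carrier G \<Longrightarrow> ?\<phi> g C = C" by (elim bexE) simp
  obtain a where a: "a \<in> carrier G" "C = K #> a" using C by (auto simp: RCOSETS_def)
  have Cs: "C \<subseteq> carrier G" using a K.subset by (simp add: r_coset_subset_G)
  have "a \<notin> K" using a coset_join2[OF a(1) K.subgroup_axioms] C(1) by auto
  moreover have "commg G x a \<in> K" if x: "x \<in> carrier G" for x
  proof -
    have "K #> conjg G x a = K #> a" using C(2)[OF x] conj[OF x a(1)] a Cs by simp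
    then have "conjg G x a \<in> K #> a"
      using rcos_self[OF conjg_closed[OF x a(1)] K.subgroup_axioms] by simp
    then obtain k where k: "k \<in> K" "conjg G x a = k \<otimes> a" by (auto simp: r_coset_def)
    have "commg G x a = conjg G x a \<otimes> inv a" by (simp add: commg_def conjg_def)
    also have "\<dots> = k" using k a subsetD[OF K.subset k(1)] by (simp add: m_assoc)
    finally show ?thesis using k by simp
  qed
  ultimately show ?thesis using a by blast
qed

lemma normal_central_mod:
  assumes "K \<lhd> G"
  shows "{g \<in> carrier G. \<forall>x\<in>carrier G. commg G x g \<in> K} \<lhd> G" (is "?Z \<lhd> G")
proof -
  interpret K: normal K G by fact
  note [simp] = m_assoc inv_mult_cancel inv_mult_group
  have mc: "g \<in> carrier G \<Longrightarrow> x \<in> carrier G \<Longrightarrow> g \<otimes> (inv g \<otimes> x) = x" for g x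
    using inv_mult_cancel[of "inv g" x] by simp
  have conjK: "conjg G g k \<in> K" if "g \<in> carrier G" "k \<in> K" for g k
    using K.inv_op_closed2[OF that] by (simp add: conjg_def)
  show ?thesis
  proof (rule normal_invI)
    show "subgroup ?Z G"
    proof
      show "?Z \<subseteq> carrier G" by auto
      show "\<one> \<in> ?Z" by (simp add: commg_def)
      fix g assume g: "g \<in> ?Z"
      { fix h assume h: "h \<in> ?Z"
        have "commg G x (g \<otimes> h) \<in> K" if x: "x \<in> carrier G" for x
        proof -
          have "commg G x (g \<otimes> h) = commg G x g \<otimes> conjg G g (commg G x h)"
            using g h x by (simp add: commg_def conjg_def)
          then show ?thesis using g h x conjK K.m_closed by simp
        qed
        then show "g \<otimes> h \<in> ?Z" using g h by simp }
      have "commg G x (inv g) \<in> K" if x: "x \<in> carrier G" for x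
      proof -
        have "commg G x (inv g) = conjg G (inv g) (inv (commg G x g))"
          using g x by (simp add: commg_def conjg_def mc)
        then show ?thesis using g x conjK K.m_inv_closed by simp
      qed
      then show "inv g \<in> ?Z" using g by simp
    qed
    fix y g assume y: "y \<in> carrier G" and g: "g \<in> ?Z"
    have "commg G x (y \<otimes> g \<otimes> inv y) \<in> K" if x: "x \<in> carrier G" for x
    proof -
      have "commg G x (y \<otimes> g \<otimes> inv y) = conjg G y (commg G (inv y \<otimes> x \<otimes> y) g)"
        using g x y by (simp add: commg_def conjg_def mc)
      then show ?thesis using g x y conjK by simp
    qed
    then show "y \<otimes> g \<otimes> inv y \<in> ?Z" using g y by simp
  qed
qed

text \<open>Quantifying over all normal K lets the induction climb from K to the preimage of the
  centre of G/K. Once the series lies in that preimage, its next term lies in K.\<close>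

lemma p_group_lcs_normal:
  assumes p: "Factorial_Ring.prime p" and G: "order G = p ^ n" and fin: "finite (carrier G)"
  shows "K \<lhd> G \<Longrightarrow> \<exists>c. lcs G (Suc c) \<subseteq> K"
proof (induction "card (carrier G) - card K" arbitrary: K rule: less_induct)
  case less
  interpret K: normal K G by (rule less.prems)
  show ?case
  proof (cases "K = carrier G")
    case True
    then have "lcs G (Suc 0) \<subseteq> K" by simp
    then show ?thesis by blast
  next
    case False
    let ?Z = "{g \<in> carrier G. \<forall>x\<in>carrier G. commg G x g \<in> K}"
    have Z: "?Z \<lhd> G" by (rule normal_central_mod[OF less.prems])
    have "K \<subseteq> ?Z"
    proof
      fix k assume k: "k \<in> K"
      then have kc: "k \<in> carrier G" using K.subset by blast
      have "commg G x k \<in> K" if x: "x \<in> carrier G" for x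
        using K.m_closed[OF K.inv_op_closed2[OF x k] K.m_inv_closed[OF k]] by (simp add: commg_def)
      then show "k \<in> ?Z" using kc by simp
    qed
    moreover obtain g where "g \<in> ?Z" "g \<notin> K"
      using p_group_central_coset[OF p G fin less.prems False] by blast
    ultimately have KZ: "K \<subset> ?Z" by blast
    have "finite ?Z" using fin by simp
    then have "card K < card ?Z" using KZ by (rule psubset_card_mono)
    moreover have "card ?Z \<le> card (carrier G)" using fin by (intro card_mono) auto
    ultimately have "card (carrier G) - card ?Z < card (carrier G) - card K" by linarith
    from less.hyps[OF this Z] obtain c where c: "lcs G (Suc c) \<subseteq> ?Z" by (elim exE) (rule that)
    have "lcs G (Suc (Suc c)) \<subseteq> K"
      unfolding lcs.simps
    proof (rule generate_subgroup_incl[OF _ K.subgroup_axioms], rule subsetI)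
      fix z assume "z \<in> {commg G x y | x y. x \<in> lcs G (Suc c) \<and> y \<in> carrier G}"
      then obtain x y where z: "z = commg G x y" "x \<in> lcs G (Suc c)" "y \<in> carrier G"
        by (elim CollectE exE conjE) (rule that)
      have "x \<in> ?Z" using c z(2) by (rule subsetD)
      then have x: "x \<in> carrier G" "commg G y x \<in> K" using z(3) by simp_all
      have "z = inv (commg G y x)"
        using x(1) z(1,3) by (simp add: commg_def inv_mult_group m_assoc)
      then show "z \<in> K" using K.m_inv_closed[OF x(2)] by simp
    qed
    then show ?thesis by blast
  qed
qed

lemma p_group_nilpotent:
  assumes p: "Factorial_Ring.prime p" and G: "order G = p ^ n" and fin: "finite (carrier G)"
  shows "\<exists>c. lcs G (Suc c) = {\<one>}"
proof -
  obtain c where c: "lcs G (Suc c) \<subseteq> {\<one>}"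
    using p_group_lcs_normal[OF p G fin one_is_normal] by blast
  moreover have "\<one> \<in> lcs G (Suc c)" by (cases c) (auto intro: generate.one)
  ultimately show ?thesis by blast
qed

end

section \<open>The exterior square as a group of permutations\<close>

lemma pres_eq_context: "pres_eq R u v \<Longrightarrow> pres_eq R (a @ u @ b) (a @ v @ b)"
proof (induction rule: pres_eq.induct)
  case (cancel u x c v)
  then show ?case using pres_eq.cancel[of R "a @ u" x c "v @ b"] by simp
next
  case (rel r u v)
  then show ?case using pres_eq.rel[of r R "a @ u" "v @ b"] by simp
next
  case (sym u w)
  show ?case by (rule pres_eq.sym[OF sym.IH])
next
  case (trans u v w)
  show ?case by (rule pres_eq.trans[OF trans.IH])
qed (rule pres_eq.refl)

lemma pres_eq_append:
  assumes "pres_eq R u v" "pres_eq R u' v'" shows "pres_eq R (u @ u') (v @ v')"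
proof (rule pres_eq.trans)
  show "pres_eq R (u @ u') (v @ u')" using pres_eq_context[OF assms(1), of "[]" u'] by simp
  show "pres_eq R (v @ u') (v @ v')" using pres_eq_context[OF assms(2), of v "[]"] by simp
qed

lemma pres_eq_right_inv: "pres_eq R (w @ inv_word w) []"
proof (induction w)
  case Nil
  show ?case by (simp add: inv_word_def pres_eq.refl)
next
  case (Cons l w)
  obtain x b where l: "l = (x, b)" by (cases l)
  have "pres_eq R ([l] @ (w @ inv_word w) @ [(x, \<not> b)]) ([l] @ [] @ [(x, \<not> b)])"
    by (rule pres_eq_context[OF Cons])
  also have "[l] @ [] @ [(x, \<not> b)] = [] @ [(x, b), (x, \<not> b)] @ []" by (simp add: l)
  finally have "pres_eq R ([l] @ (w @ inv_word w) @ [(x, \<not> b)]) ([] @ [])"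
    by (rule pres_eq.trans[OF _ pres_eq.cancel])
  then show ?case by (simp add: inv_word_def l)
qed

lemma inv_word_inv_word: "inv_word (inv_word w) = w"
  by (simp add: inv_word_def rev_map o_def case_prod_unfold)

lemma pres_eq_left_inv: "pres_eq R (inv_word w @ w) []"
  using pres_eq_right_inv[of R "inv_word w"] by (simp add: inv_word_inv_word)

lemma pres_eq_of_relator: "u @ inv_word v \<in> R \<Longrightarrow> pres_eq R u v"
proof -
  assume "u @ inv_word v \<in> R"
  then have "pres_eq R ([] @ (u @ inv_word v) @ v) ([] @ v)" by (rule pres_eq.rel)
  then have 1: "pres_eq R (u @ inv_word v @ v) v" by simp
  have "pres_eq R (u @ (inv_word v @ v) @ []) (u @ [] @ [])"
    by (rule pres_eq_context[OF pres_eq_left_inv])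
  then have "pres_eq R (u @ inv_word v @ v) u" by simp
  from pres_eq.trans[OF pres_eq.sym[OF this] 1] show ?thesis .
qed

lemma word_class_eq: "word_class R u = word_class R v \<longleftrightarrow> pres_eq R u v"
proof
  assume "word_class R u = word_class R v"
  moreover have "v \<in> word_class R v" by (simp add: word_class_def pres_eq.refl)
  ultimately show "pres_eq R u v" by (auto simp: word_class_def)
next
  assume "pres_eq R u v"
  then show "word_class R u = word_class R v"
    using pres_eq.trans[OF pres_eq.sym[of R u v]] pres_eq.trans[of R u v]
    unfolding word_class_def by auto
qed

lemma presented_group_mult:
  "word_class R u \<otimes>\<^bsub>presented_group R\<^esub> word_class R v = word_class R (u @ v)"
proof
  show "word_class R u \<otimes>\<^bsub>presented_group R\<^esub> word_class R v \<subseteq> word_class R (u @ v)"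
  proof
    fix x assume "x \<in> word_class R u \<otimes>\<^bsub>presented_group R\<^esub> word_class R v"
    then obtain a b where ab: "pres_eq R u a" "pres_eq R v b" "pres_eq R (a @ b) x"
      by (auto simp: presented_group_def word_class_def)
    from pres_eq.trans[OF pres_eq_append[OF ab(1,2)] ab(3)]
    show "x \<in> word_class R (u @ v)" by (simp add: word_class_def)
  qed
  show "word_class R (u @ v) \<subseteq> word_class R u \<otimes>\<^bsub>presented_group R\<^esub> word_class R v"
    using pres_eq.refl[of R] by (auto simp: presented_group_def word_class_def)
qed

lemma presented_group_one: "\<one>\<^bsub>presented_group R\<^esub> = word_class R []"
  by (simp add: presented_group_def)

lemma presented_group_carrier: "carrier (presented_group R) = range (word_class R)"
  by (simp add: presented_group_def)

lemma presented_group_monoid: "monoid (presented_group R)"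
proof (rule monoidI)
  let ?M = "presented_group R"
  fix x y z assume "x \<in> carrier ?M" "y \<in> carrier ?M" "z \<in> carrier ?M"
  then obtain u v w where "x = word_class R u" "y = word_class R v" "z = word_class R w"
    by (auto simp: presented_group_carrier)
  then show "x \<otimes>\<^bsub>?M\<^esub> y \<otimes>\<^bsub>?M\<^esub> z = x \<otimes>\<^bsub>?M\<^esub> (y \<otimes>\<^bsub>?M\<^esub> z)" "x \<otimes>\<^bsub>?M\<^esub> y \<in> carrier ?M"
    "\<one>\<^bsub>?M\<^esub> \<otimes>\<^bsub>?M\<^esub> x = x" "x \<otimes>\<^bsub>?M\<^esub> \<one>\<^bsub>?M\<^esub> = x"
    by (simp_all add: presented_group_carrier presented_group_one presented_group_mult)
qed (simp add: presented_group_carrier presented_group_one)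

lemma presented_group_pow:
  "word_class R u [^]\<^bsub>presented_group R\<^esub> (n::nat) = word_class R (concat (replicate n u))"
proof (induction n)
  case 0
  then show ?case by (simp add: nat_pow_def presented_group_one)
next
  case (Suc n)
  have "concat (replicate n u) @ u = u @ concat (replicate n u)" by (induction n) auto
  with Suc show ?case by (simp add: nat_pow_def presented_group_mult)
qed

text \<open>Permutations of a type hold the left multiplications and the conjugation action of G
  inside one instance of \<open>grp\<close>.\<close>

typedef 'b sym = "{f :: 'b \<Rightarrow> 'b. bij f}"
  by (rule exI[of _ id]) simp

instantiation sym :: (type) grp
begin
definition "one_sym = Abs_sym id"
definition "times_sym f g = Abs_sym (Rep_sym f \<circ> Rep_sym g)"
definition "iv_sym f = Abs_sym (inv_into UNIV (Rep_sym f))"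
instance
proof
  have bij: "bij (Rep_sym f)" for f :: "'b sym" using Rep_sym[of f] by simp
  fix a b c :: "'b sym"
  show "a * b * c = a * (b * c)"
    by (simp add: times_sym_def Abs_sym_inverse bij bij_comp o_assoc)
  show "1 * a = a" "a * 1 = a"
    by (simp_all add: times_sym_def one_sym_def Abs_sym_inverse Rep_sym_inverse)
  show "iv a * a = 1"
    using bij[of a] by (simp add: times_sym_def one_sym_def iv_sym_def Abs_sym_inverse bij_imp_bij_inv
        bij_is_inj)
qed
end

lemma Abs_sym_times: "bij f \<Longrightarrow> bij g \<Longrightarrow> Abs_sym f * Abs_sym g = Abs_sym (f \<circ> g)"
  by (simp add: times_sym_def Abs_sym_inverse)

lemma Abs_sym_eq: "bij f \<Longrightarrow> bij g \<Longrightarrow> Abs_sym f = Abs_sym g \<longleftrightarrow> f = g"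
  by (simp add: Abs_sym_inject)

text \<open>The identity off the classes, so that invertible maps of classes become permutations of the
  whole type; the \<open>SOME\<close> representative only matters up to \<open>pres_eq\<close>.\<close>
definition on_classes :: "'g word set \<Rightarrow> ('g word \<Rightarrow> 'g word) \<Rightarrow> 'g word set \<Rightarrow> 'g word set" where
  "on_classes R f A = (if A \<in> range (word_class R) then word_class R (f (SOME u. A = word_class R u)) else A)"

definition compat :: "'g word set \<Rightarrow> ('g word \<Rightarrow> 'g word) \<Rightarrow> bool" where
  "compat R f \<longleftrightarrow> (\<forall>u v. pres_eq R u v \<longrightarrow> pres_eq R (f u) (f v))"

lemma on_classes_class: "compat R f \<Longrightarrow> on_classes R f (word_class R u) = word_class R (f u)"
proof -
  assume f: "compat R f"
  have "word_class R u = word_class R (SOME v. word_class R u = word_class R v)"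
    by (rule someI_ex) auto
  then have "pres_eq R u (SOME v. word_class R u = word_class R v)" (is "pres_eq R u ?v")
    unfolding word_class_eq[of R u "?v"] .
  then have "word_class R (f u) = word_class R (f ?v)"
    using f by (simp only: compat_def word_class_eq)
  then show ?thesis by (simp add: on_classes_def)
qed

lemma on_classes_comp:
  assumes "compat R f" "compat R g"
  shows "on_classes R f \<circ> on_classes R g = on_classes R (f \<circ> g)"
proof
  fix A
  have fg: "compat R (f \<circ> g)" using assms by (simp add: compat_def)
  show "(on_classes R f \<circ> on_classes R g) A = on_classes R (f \<circ> g) A"
  proof (cases "A \<in> range (word_class R)")
    case True
    then obtain u where "A = word_class R u" by blast
    then show ?thesis using assms fg by (simp add: on_classes_class)
  next
    case False
    then have "on_classes R h A = A" for h unfolding on_classes_def by simp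
    then show ?thesis by simp
  qed
qed

lemma on_classes_cong:
  assumes "compat R f" "compat R g" "\<And>u. pres_eq R (f u) (g u)"
  shows "on_classes R f = on_classes R g"
proof
  fix A
  show "on_classes R f A = on_classes R g A"
  proof (cases "A \<in> range (word_class R)")
    case True
    then obtain u where "A = word_class R u" by blast
    then show ?thesis using assms by (simp add: on_classes_class word_class_eq)
  next
    case False
    then have "on_classes R h A = A" for h unfolding on_classes_def by simp
    then show ?thesis by simp
  qed
qed

lemma on_classes_id: "on_classes R (\<lambda>u. u) = id"
proof
  fix A
  have "compat R (\<lambda>u. u)" by (simp add: compat_def)
  then show "on_classes R (\<lambda>u. u) A = id A"
    using on_classes_class[of R "\<lambda>u. u"] by (cases "A \<in> range (word_class R)") (auto simp: on_classes_def)
qed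

lemma on_classes_bij:
  assumes "compat R f" "compat R g" "\<And>u. pres_eq R (f (g u)) u" "\<And>u. pres_eq R (g (f u)) u"
  shows "bij (on_classes R f)"
proof (rule o_bij)
  have r: "compat R (\<lambda>u. u)" "compat R (f \<circ> g)" "compat R (g \<circ> f)"
    using assms(1,2) by (simp_all add: compat_def)
  show "on_classes R g \<circ> on_classes R f = id"
    unfolding on_classes_comp[OF assms(2,1)] on_classes_id[of R, symmetric]
    using assms(4) by (intro on_classes_cong r) simp
  show "on_classes R f \<circ> on_classes R g = id"
    unfolding on_classes_comp[OF assms(1,2)] on_classes_id[of R, symmetric]
    using assms(3) by (intro on_classes_cong r) simp
qed

lemma compat_append: "compat R ((@) u)"
  by (simp add: compat_def pres_eq_append pres_eq.refl)

lemma bij_append: "bij (on_classes R ((@) u))"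
proof (rule on_classes_bij[OF compat_append compat_append[of R "inv_word u"]])
  show "pres_eq R (u @ inv_word u @ v) v" for v
    using pres_eq_append[OF pres_eq_right_inv[of R u] pres_eq.refl[of R v]] by simp
  show "pres_eq R (inv_word u @ u @ v) v" for v
    using pres_eq_append[OF pres_eq_left_inv[of R u] pres_eq.refl[of R v]] by simp
qed

definition lmult :: "'g word set \<Rightarrow> 'g word \<Rightarrow> 'g word set sym" where
  "lmult R u = Abs_sym (on_classes R ((@) u))"

lemma lmult_append: "lmult R (u @ v) = lmult R u * lmult R v"
proof -
  have "(@) u \<circ> (@) v = (@) (u @ v)" by auto
  then show ?thesis
    by (simp add: lmult_def Abs_sym_times bij_append on_classes_comp compat_append)
qed

text \<open>The left regular representation is faithful: evaluation at the class of the empty word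
  recovers the class of \<open>u\<close>.\<close>

lemma lmult_eq: "lmult R u = lmult R v \<longleftrightarrow> pres_eq R u v"
proof
  assume "pres_eq R u v"
  then have "on_classes R ((@) u) = on_classes R ((@) v)"
    by (intro on_classes_cong compat_append pres_eq_append pres_eq.refl)
  then show "lmult R u = lmult R v" by (simp add: lmult_def)
next
  assume "lmult R u = lmult R v"
  then have "on_classes R ((@) u) (word_class R []) = on_classes R ((@) v) (word_class R [])"
    by (simp add: lmult_def Abs_sym_eq bij_append)
  then show "pres_eq R u v" by (simp add: on_classes_class compat_append word_class_eq)
qed

lemma lmult_Nil: "lmult R [] = 1"
proof -
  have "on_classes R ((@) []) = on_classes R (\<lambda>u. u)"
    by (rule arg_cong[where f = "on_classes R"]) auto
  then show ?thesis unfolding lmult_def one_sym_def by (simp only: on_classes_id)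
qed

lemma lmult_eq_one: "lmult R u = 1 \<longleftrightarrow> pres_eq R u []"
  using lmult_eq[of R u "[]"] by (simp add: lmult_Nil)

lemma lmult_inv_word: "lmult R (inv_word u) = iv (lmult R u)"
proof -
  have "lmult R u * lmult R (inv_word u) = 1"
    using pres_eq_right_inv[of R u] lmult_eq[of R "u @ inv_word u" "[]"]
    by (simp add: lmult_append lmult_Nil)
  then show ?thesis by (simp add: iv_unique)
qed

lemma lmult_power: "lmult R (concat (replicate n u)) = lmult R u ^ n"
  by (induction n) (simp_all add: lmult_append lmult_Nil)

section \<open>Conjugation of words and the exterior pairing it provides\<close>

context group
begin

text \<open>Components outside the carrier stay fixed, so that killed letters go to killed letters
  and conjugation by the unit is the identity on all words.\<close>

definition conj_word :: "'a \<Rightarrow> ('a \<times> 'a) word \<Rightarrow> ('a \<times> 'a) word" where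
  "conj_word k = map (\<lambda>((x, y), b).
     ((if x \<in> carrier G then conjg G k x else x, if y \<in> carrier G then conjg G k y else y), b))"

lemma conj_word_append: "conj_word k (u @ v) = conj_word k u @ conj_word k v"
  by (simp add: conj_word_def)

lemma conj_word_inv: "conj_word k (inv_word u) = inv_word (conj_word k u)"
  by (simp add: conj_word_def inv_word_def rev_map o_def case_prod_unfold)

lemma conj_word_pair: "x \<in> carrier G \<Longrightarrow> y \<in> carrier G \<Longrightarrow>
    conj_word k (((x, y), b) # u) = ((conjg G k x, conjg G k y), b) # conj_word k u"
  by (simp add: conj_word_def)

lemma conj_word_Nil: "conj_word k [] = []"
  by (simp add: conj_word_def)

lemma conjg_conjg:
  assumes "k \<in> carrier G" "g \<in> carrier G" "h \<in> carrier G"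
  shows "conjg G k (conjg G g h) = conjg G (conjg G k g) (conjg G k h)"
    and "conjg G (k \<otimes> g) h = conjg G k (conjg G g h)"
  using assms by (simp_all add: conjg_def m_assoc inv_mult_group inv_mult_cancel)

lemma conj_word_comp:
  "k \<in> carrier G \<Longrightarrow> g \<in> carrier G \<Longrightarrow> conj_word k (conj_word g u) = conj_word (k \<otimes> g) u"
  by (auto simp: conj_word_def conjg_conjg(2))

lemma conj_word_one: "conj_word \<one> u = u"
  by (induction u) (auto simp: conj_word_def conjg_def)

lemma conj_word_relator:
  assumes k: "k \<in> carrier G" and r: "r \<in> ext_relators G"
  shows "conj_word k r \<in> ext_relators G"
proof -
  show ?thesis
    using r[unfolded ext_relators_def]
  proof (elim UnE)
    assume "r \<in> {[((g \<otimes> g', h), True)] @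
        inv_word [((conjg G g g', conjg G g h), True), ((g, h), True)]
       | g g' h. g \<in> carrier G \<and> g' \<in> carrier G \<and> h \<in> carrier G}"
    then obtain g g' h where left: "r = [((g \<otimes> g', h), True)] @
        inv_word [((conjg G g g', conjg G g h), True), ((g, h), True)]"
        "g \<in> carrier G" "g' \<in> carrier G" "h \<in> carrier G"
      by (elim CollectE exE conjE) (rule that)
    have "conj_word k r = [((conjg G k g \<otimes> conjg G k g', conjg G k h), True)] @
        inv_word [((conjg G (conjg G k g) (conjg G k g'), conjg G (conjg G k g) (conjg G k h)), True),
          ((conjg G k g, conjg G k h), True)]"
      unfolding left(1) conj_word_append conj_word_inv using k left(2-)
      by (simp add: conj_word_pair conj_word_Nil conjg_mult
          conjg_conjg(1)[OF k left(2,3)] conjg_conjg(1)[OF k left(2,4)])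
    moreover have "conjg G k g \<in> carrier G" "conjg G k g' \<in> carrier G" "conjg G k h \<in> carrier G"
      using k left(2-) by simp_all
    ultimately show ?thesis unfolding ext_relators_def by blast
  next
    assume "r \<in> {[((g, h \<otimes> h'), True)] @
        inv_word [((g, h), True), ((conjg G h g, conjg G h h'), True)]
       | g h h'. g \<in> carrier G \<and> h \<in> carrier G \<and> h' \<in> carrier G}"
    then obtain g h h' where right: "r = [((g, h \<otimes> h'), True)] @
        inv_word [((g, h), True), ((conjg G h g, conjg G h h'), True)]"
        "g \<in> carrier G" "h \<in> carrier G" "h' \<in> carrier G"
      by (elim CollectE exE conjE) (rule that)
    have "conj_word k r = [((conjg G k g, conjg G k h \<otimes> conjg G k h'), True)] @
        inv_word [((conjg G k g, conjg G k h), True),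
          ((conjg G (conjg G k h) (conjg G k g), conjg G (conjg G k h) (conjg G k h')), True)]"
      unfolding right(1) conj_word_append conj_word_inv using k right(2-)
      by (simp add: conj_word_pair conj_word_Nil conjg_mult
          conjg_conjg(1)[OF k right(3,2)] conjg_conjg(1)[OF k right(3,4)])
    moreover have "conjg G k g \<in> carrier G" "conjg G k h \<in> carrier G" "conjg G k h' \<in> carrier G"
      using k right(2-) by simp_all
    ultimately show ?thesis unfolding ext_relators_def by blast
  next
    assume "r \<in> {[((g, g), True)] | g. g \<in> carrier G}"
    then obtain g where "r = [((g, g), True)]" "g \<in> carrier G"
      by (elim CollectE exE conjE) (rule that)
    then have "conj_word k r = [((conjg G k g, conjg G k g), True)]" "conjg G k g \<in> carrier G"
      using k by (simp_all add: conj_word_pair conj_word_Nil)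
    then show ?thesis unfolding ext_relators_def by blast
  next
    assume "r \<in> {[((g, h), True)] | g h. \<not> (g \<in> carrier G \<and> h \<in> carrier G)}"
    then obtain g h where outside: "r = [((g, h), True)]" "\<not> (g \<in> carrier G \<and> h \<in> carrier G)"
      by (elim CollectE exE conjE) (rule that)
    define g' h' where "g' = (if g \<in> carrier G then conjg G k g else g)"
      and "h' = (if h \<in> carrier G then conjg G k h else h)"
    have "conj_word k r = [((g', h'), True)]" using outside by (simp add: conj_word_def g'_def h'_def)
    moreover have "\<not> (g' \<in> carrier G \<and> h' \<in> carrier G)"
      using outside k by (auto simp: g'_def h'_def)
    ultimately show ?thesis unfolding ext_relators_def by blast
  qed
qed

abbreviation "ER \<equiv> ext_relators G"

lemma compat_conj_word:
  assumes k: "k \<in> carrier G" shows "compat ER (conj_word k)"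
proof -
  have "pres_eq ER (conj_word k u) (conj_word k v)" if "pres_eq ER u v" for u v
    using that
  proof (induction rule: pres_eq.induct)
    case (cancel u x b v)
    obtain x1 x2 where "x = (x1, x2)" by (cases x)
    then show ?case
      using pres_eq.cancel[of ER "conj_word k u" _ b "conj_word k v"]
      by (simp add: conj_word_append) (simp add: conj_word_def)
  next
    case (rel r u v)
    then show ?case
      using pres_eq.rel[OF conj_word_relator[OF k], of r "conj_word k u" "conj_word k v"]
      by (simp add: conj_word_append)
  next
    case (sym u w)
    show ?case by (rule pres_eq.sym[OF sym.IH])
  next
    case (trans u v w)
    show ?case by (rule pres_eq.trans[OF trans.IH])
  qed (rule pres_eq.refl)
  then show ?thesis by (simp add: compat_def)
qed

definition conj_sym :: "'a \<Rightarrow> ('a \<times> 'a) word set sym" where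
  "conj_sym k = Abs_sym (on_classes ER (conj_word k))"

lemma bij_conj_word: "k \<in> carrier G \<Longrightarrow> bij (on_classes ER (conj_word k))"
  by (rule on_classes_bij[of _ _ "conj_word (inv k)"])
    (simp_all add: compat_conj_word conj_word_comp conj_word_one pres_eq.refl)

lemma ext_pairing_lmult: "ext_pairing G conj_sym (\<lambda>g h. lmult ER [((g, h), True)])"
proof
  fix g h assume g: "g \<in> carrier G" and h: "h \<in> carrier G"
  have "conj_word g \<circ> conj_word h = conj_word (g \<otimes> h)" using g h by (auto simp: conj_word_comp)
  then show "conj_sym (g \<otimes> h) = conj_sym g * conj_sym h"
    using g h by (simp add: conj_sym_def Abs_sym_times bij_conj_word on_classes_comp compat_conj_word)
next
  fix k g h assume k: "k \<in> carrier G" and g: "g \<in> carrier G" and h: "h \<in> carrier G"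
  let ?u = "[((g, h), True)]"
  \<comment> \<open>Conjugating a left multiplication by an automorphism gives left multiplication
    by the image.\<close>
  have "conj_word k \<circ> (@) ?u = (@) (conj_word k ?u) \<circ> conj_word k"
    by (rule ext) (simp only: comp_def conj_word_append)
  then have "conj_sym k * lmult ER ?u = lmult ER (conj_word k ?u) * conj_sym k"
    using k by (simp add: conj_sym_def lmult_def Abs_sym_times bij_conj_word bij_append
        on_classes_comp compat_conj_word compat_append del: append_Cons)
  then have "conj_sym k * lmult ER ?u * iv (conj_sym k) = lmult ER (conj_word k ?u)"
    by (simp add: mult.assoc)
  then show "lmult ER [((conjg G k g, conjg G k h), True)] = conj_sym k * lmult ER ?u * iv (conj_sym k)"
    using g h by (simp add: conj_word_pair conj_word_Nil)
next
  fix g g' h assume "g \<in> carrier G" "g' \<in> carrier G" "h \<in> carrier G"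
  then have "[((g \<otimes> g', h), True)] @ inv_word [((conjg G g g', conjg G g h), True), ((g, h), True)] \<in> ER"
    unfolding ext_relators_def by blast
  from pres_eq_of_relator[OF this]
  have "lmult ER [((g \<otimes> g', h), True)] =
      lmult ER ([((conjg G g g', conjg G g h), True)] @ [((g, h), True)])" by (simp add: lmult_eq)
  then show "lmult ER [((g \<otimes> g', h), True)] =
      lmult ER [((conjg G g g', conjg G g h), True)] * lmult ER [((g, h), True)]"
    by (simp only: lmult_append)
next
  fix g h h' assume "g \<in> carrier G" "h \<in> carrier G" "h' \<in> carrier G"
  then have "[((g, h \<otimes> h'), True)] @ inv_word [((g, h), True), ((conjg G h g, conjg G h h'), True)] \<in> ER"
    unfolding ext_relators_def by blast
  from pres_eq_of_relator[OF this]
  have "lmult ER [((g, h \<otimes> h'), True)] =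
      lmult ER ([((g, h), True)] @ [((conjg G h g, conjg G h h'), True)])" by (simp add: lmult_eq)
  then show "lmult ER [((g, h \<otimes> h'), True)] =
      lmult ER [((g, h), True)] * lmult ER [((conjg G h g, conjg G h h'), True)]"
    by (simp only: lmult_append)
next
  fix g assume "g \<in> carrier G"
  then have "[((g, g), True)] @ inv_word [] \<in> ER" unfolding ext_relators_def inv_word_def by auto
  from pres_eq_of_relator[OF this] show "lmult ER [((g, g), True)] = 1"
    by (simp add: lmult_eq_one)
qed

lemma ext_square_pow_eq_one:
  assumes p: "Factorial_Ring.prime p" and nil: "lcs G (Suc c) = {\<one>}"
    and exp: "\<And>y. y \<in> carrier G \<Longrightarrow> y [^] (p ^ e) = \<one>"
    and hyp: "(p \<ge> 3 \<and> lcs G (p - 1) \<subseteq> power_subgroup G p) \<or> lcs G p \<subseteq> power_subgroup G (p ^ 2)"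
    and A: "A \<in> carrier (ext_square G)"
  shows "A [^]\<^bsub>ext_square G\<^esub> (p ^ e) = \<one>\<^bsub>ext_square G\<^esub>"
proof -
  interpret ext_pairing G conj_sym "\<lambda>g h. lmult ER [((g, h), True)]" by (rule ext_pairing_lmult)
  have E: "subgp E" by (simp add: E_def pair_span_def subgp_gen)
  \<comment> \<open>Letters outside the carrier are relators and act as 1, so no restriction on g
    and h is needed here.\<close>
  have letter: "lmult ER [((g, h), b)] \<in> E" for g h b
  proof -
    have "lmult ER [((g, h), True)] \<in> E"
    proof (cases "g \<in> carrier G \<and> h \<in> carrier G")
      case True
      then show ?thesis unfolding E_def by (intro w_pair_span) simp
    next
      case False
      then have "[((g, h), True)] @ inv_word [] \<in> ER" unfolding ext_relators_def inv_word_def by auto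
      from pres_eq_of_relator[OF this] have "lmult ER [((g, h), True)] = 1"
        by (simp add: lmult_eq_one)
      then show ?thesis using subgpD(1)[OF E] by simp
    qed
    moreover have "lmult ER [((g, h), False)] = iv (lmult ER [((g, h), True)])"
      by (simp add: inv_word_def flip: lmult_inv_word)
    ultimately show ?thesis using subgpD(3)[OF E] by (cases b) simp_all
  qed
  have E_word: "lmult ER u \<in> E" for u
  proof (induction u)
    case (Cons l u)
    obtain g h b where l: "l = ((g, h), b)" by (metis surj_pair)
    have "lmult ER (l # u) = lmult ER [l] * lmult ER u" by (simp flip: lmult_append)
    then show ?case using subgpD(2)[OF E letter Cons, of g h b] l by simp
  qed (simp add: lmult_Nil subgpD(1)[OF E])
  obtain u where u: "A = word_class ER u" using A by (auto simp: ext_square_def presented_group_carrier)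
  have "lmult ER (concat (replicate (p ^ e) u)) = lmult ER []"
    using power_eq_one[OF p nil exp hyp E_word] by (simp add: lmult_power lmult_Nil)
  then have "pres_eq ER (concat (replicate (p ^ e) u)) []" by (simp add: lmult_eq)
  then show ?thesis
    by (simp add: u ext_square_def presented_group_pow presented_group_one word_class_eq)
qed

end

section \<open>Exponents\<close>

text \<open>Stated for a changed carrier so that it covers G, its exterior square and the Schur
  multiplier alike; only \<open>monoid\<close> is assumed because that is what
  \<open>presented_group_monoid\<close> supplies.\<close>

lemma grp_exponent_dvd:
  assumes M: "monoid M" and S: "S \<subseteq> carrier M" and N: "0 < N"
    and exp: "\<And>x. x \<in> S \<Longrightarrow> x [^]\<^bsub>M\<^esub> (N::nat) = \<one>\<^bsub>M\<^esub>"
  shows "grp_exponent (M\<lparr>carrier := S\<rparr>) dvd N"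
    and "x \<in> S \<Longrightarrow> x [^]\<^bsub>M\<^esub> grp_exponent (M\<lparr>carrier := S\<rparr>) = \<one>\<^bsub>M\<^esub>"
proof -
  interpret monoid M by (rule M)
  let ?P = "\<lambda>n::nat. 0 < n \<and> (\<forall>x\<in>S. x [^]\<^bsub>M\<^esub> n = \<one>\<^bsub>M\<^esub>)"
  define m where "m = (LEAST n. ?P n)"
  have ex: "?P N" using N exp by blast
  define H where "H = M\<lparr>carrier := S\<rparr>"
  have H: "(\<forall>x\<in>carrier H. x [^]\<^bsub>H\<^esub> n = \<one>\<^bsub>H\<^esub>) \<longleftrightarrow> (\<forall>x\<in>S. x [^]\<^bsub>M\<^esub> n = \<one>\<^bsub>M\<^esub>)" for n :: nat
    by (simp add: H_def nat_pow_consistent[symmetric])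
  have "grp_exponent H = m"
    unfolding grp_exponent_def H m_def using N exp by (intro if_P exI[of _ N] conjI ballI)
  then have m: "grp_exponent (M\<lparr>carrier := S\<rparr>) = m" by (simp only: H_def)
  have Pm: "?P m" unfolding m_def by (rule LeastI[of ?P, OF ex])
  show "x \<in> S \<Longrightarrow> x [^]\<^bsub>M\<^esub> grp_exponent (M\<lparr>carrier := S\<rparr>) = \<one>\<^bsub>M\<^esub>"
    using Pm by (simp add: m)
  have rem: "x [^]\<^bsub>M\<^esub> (N mod m) = \<one>\<^bsub>M\<^esub>" if x: "x \<in> S" for x
  proof -
    have xM: "x \<in> carrier M" using x S by blast
    have "N = m * (N div m) + N mod m" by simp
    then have "x [^]\<^bsub>M\<^esub> N = (x [^]\<^bsub>M\<^esub> m) [^]\<^bsub>M\<^esub> (N div m) \<otimes>\<^bsub>M\<^esub> x [^]\<^bsub>M\<^esub> (N mod m)"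
      using xM nat_pow_mult[OF xM, of "m * (N div m)" "N mod m"] nat_pow_pow[OF xM, of m "N div m"]
      by simp
    then show ?thesis using exp[OF x] Pm x xM by simp
  qed
  \<comment> \<open>The remainder is smaller than the least exponent and also annihilates
    \<open>S\<close>, so it must be 0.\<close>
  have "\<not> ?P (N mod m)"
    using not_less_Least[of "N mod m" ?P] Pm unfolding m_def[symmetric] by simp
  then have "N mod m = 0" using rem by simp
  then show "grp_exponent (M\<lparr>carrier := S\<rparr>) dvd N" by (simp add: m mod_eq_0_iff_dvd)
qed

lemma (in group) subgroup_lcs: "subgroup (lcs G k) G"
proof (cases k)
  case (Suc j)
  show ?thesis
  proof (cases j)
    case (Suc i)
    have "{commg G x y | x y. x \<in> lcs G (Suc i) \<and> y \<in> carrier G} \<subseteq> carrier G"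
      using subsetD[OF lcs_carrier[of "Suc i"]] by (auto simp del: lcs.simps)
    then show ?thesis using generate_is_subgroup \<open>k = Suc j\<close> Suc by simp
  qed (use Suc subgroup_self in simp)
qed (use subgroup_self in simp)

lemma (in group) lcs_Suc_subset: "lcs G (Suc k) \<subseteq> lcs G k"
proof (cases k)
  case 0
  then show ?thesis by simp
next
  case (Suc j)
  interpret L: subgroup "lcs G (Suc j)" G by (rule subgroup_lcs)
  have "lcs G (Suc (Suc j)) \<subseteq> lcs G (Suc j)"
    unfolding lcs.simps(3)
  proof (rule generate_subgroup_incl[OF _ subgroup_lcs], rule subsetI)
    fix z assume "z \<in> {commg G x y | x y. x \<in> lcs G (Suc j) \<and> y \<in> carrier G}"
    then obtain x y where z: "z = commg G x y" "x \<in> lcs G (Suc j)" "y \<in> carrier G"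
      by (elim CollectE exE conjE) (rule that)
    have x: "x \<in> carrier G" by (rule subsetD[OF lcs_carrier z(2)])
    have "z = x \<otimes> conjg G y (inv x)" using x z by (simp add: commg_def conjg_def m_assoc)
    then show "z \<in> lcs G (Suc j)"
      using L.m_closed[OF z(2) lcs_conjg[OF z(3) L.m_inv_closed[OF z(2)]]] by simp
  qed
  then show ?thesis by (simp only: Suc)
qed

theorem theorem4p9:
  fixes G :: "'a monoid" and p :: nat
  assumes "Factorial_Ring.prime p" and "odd p"
    and "group G" and "finite (carrier G)"
    and "\<exists>n. card (carrier G) = p ^ n"
    and "(\<exists>m::nat. 2 \<le> m \<and> m \<le> p - 1 \<and> lcs G m \<subseteq> power_subgroup G p)
         \<or> lcs G p \<subseteq> power_subgroup G (p ^ 2)"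
  shows "grp_exponent (ext_square G) dvd grp_exponent G
         \<and> grp_exponent (schur_multiplier G) dvd grp_exponent G"
proof -
  interpret group G by fact
  note p = assms(1)
  obtain n where n: "order G = p ^ n" using assms(5) by (auto simp: order_def)
  have p0: "0 < p" by (rule prime_gt_0_nat[OF p])
  have ord: "x [^]\<^bsub>G\<^esub> (p ^ n) = \<one>\<^bsub>G\<^esub>" if "x \<in> carrier G" for x
    using pow_order_eq_1[OF that] n by simp
  have pn: "0 < p ^ n" using p0 by simp
  have "G\<lparr>carrier := carrier G\<rparr> = G" by simp
  note E = grp_exponent_dvd[OF is_monoid subset_refl pn ord, unfolded this]
  obtain e where e: "grp_exponent G = p ^ e" using E(1) divides_primepow_nat[OF p] by auto
  obtain c where c: "lcs G (Suc c) = {\<one>\<^bsub>G\<^esub>}" using p_group_nilpotent[OF p n assms(4)] by blast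
  have hyp: "(p \<ge> 3 \<and> lcs G (p - 1) \<subseteq> power_subgroup G p) \<or> lcs G p \<subseteq> power_subgroup G (p ^ 2)"
    using assms(6)
  proof
    assume "\<exists>m::nat. 2 \<le> m \<and> m \<le> p - 1 \<and> lcs G m \<subseteq> power_subgroup G p"
    then obtain m where m: "2 \<le> m" "m \<le> p - 1" "lcs G m \<subseteq> power_subgroup G p" by blast
    \<comment> \<open>The series descends, so condition (i) for any admissible m gives it for p -
      1.\<close>
    have "lcs G (p - 1) \<subseteq> lcs G m" using lift_Suc_antimono_le[of "lcs G", OF lcs_Suc_subset m(2)] .
    then show ?thesis using m by auto
  qed simp
  let ?M = "ext_square G"
  have M: "monoid ?M" unfolding ext_square_def by (rule presented_group_monoid)
  have exp: "A [^]\<^bsub>?M\<^esub> (p ^ e) = \<one>\<^bsub>?M\<^esub>" if "A \<in> carrier ?M" for A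
    using E(2) by (intro ext_square_pow_eq_one[OF p c _ hyp that]) (simp add: e)
  have pe: "0 < p ^ e" using p0 by simp
  have "grp_exponent (?M\<lparr>carrier := S\<rparr>) dvd p ^ e" if "S \<subseteq> carrier ?M" for S
    using grp_exponent_dvd(1)[OF M that pe] exp that by blast
  from this[of "carrier ?M"] this[of "{A \<in> carrier ?M. \<exists>w\<in>A. comm_eval G w = \<one>\<^bsub>G\<^esub>}"]
  show ?thesis by (simp add: e schur_multiplier_def)
qed

end
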